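(* Let $\alpha\ge 0$, $\beta\ge 0$ satisfy $\alpha+\beta\le 1$, and let $C=\int_0^\infty\log_2(1+\gamma)f_\gamma(\gamma)\,d\gamma$ be the average capacity (with normalized bandwidth $1$) of the normalized SOSF fading channel with parameters $(\alpha,\beta)$ and average SNR $\bar\gamma$, where $f_\gamma$ is the PDF of its instantaneous SNR. Then the asymptotic capacity in the high-SNR regime (large $\bar\gamma$) is $$C\big|_{\bar\gamma\Uparrow}\approx\log_2(\bar\gamma)-t,$$ where $$t=-\log_2(\beta)-\log_2(e)\int_{0}^{\infty}E_1\!\left(\frac{\beta}{1-\beta-\alpha(1-x)}\right) e^{-x}\,dx$$ can be regarded as a capacity loss with respect to the AWGN case and does not depend on $\bar\gamma$.
   Context: SOSF (second order scattering fading) channel: $S=\omega_0e^{j\phi}+\omega_1G_1+\omega_2G_2G_3$, where $j$ is the imaginary unit, $\omega_0,\omega_1,\omega_2\ge 0$ are real constants with $\omega_0^2+\omega_1^2+\omega_2^2=1$, $\phi$ is uniform on $[0,2\pi)$, and $G_1,G_2,G_3$ are circularly-symmetric complex Gaussian random variables with mean $0$ and variance $\mathbb{E}|G_i|^2=1$; $\phi,G_1,G_2,G_3$ are mutually independent. The parameters are $\alpha=\omega_2^2$ and $\beta=\omega_0^2$ (so $\omega_1^2=1-\alpha-\beta$). The instantaneous SNR is $\gamma=\bar\gamma|S|^2$, so that $\mathbb{E}(\gamma)=\bar\gamma$. $E_1(x)=\int_x^\infty \frac{e^{-z}}{z}\,dz$ is the exponential integral. The AWGN case is the channel without fading, whose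 high-SNR capacity is $\log_2(\bar\gamma)$. The notation $C|_{\bar\gamma\Uparrow}\approx\cdots$ denotes the high-SNR approximation of the capacity. For $\beta=0$ the expression for $t$ is understood as its limit when $\beta\to0$. *)

theory Defs
  imports "HOL-Probability.Probability"
begin

definition circular_complex_gaussian :: "'a measure \<Rightarrow> ('a \<Rightarrow> complex) \<Rightarrow> real \<Rightarrow> bool" where
  "circular_complex_gaussian M G v \<longleftrightarrow>
     prob_space.indep_var M borel (\<lambda>w. Re (G w)) borel (\<lambda>w. Im (G w)) \<and>
     distributed M lborel (\<lambda>w. Re (G w)) (normal_density 0 (sqrt (v / 2))) \<and>
     distributed M lborel (\<lambda>w. Im (G w)) (normal_density 0 (sqrt (v / 2)))"

text \<open>
  Library independence needs one common codomain, hence the phase enters the independent family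
  through the embedding of the reals into the complex numbers; this does not change the
  sigma-algebra it generates.
\<close>

locale sosf_channel = prob_space M
  for M :: "'a measure" +
  fixes \<phi> :: "'a \<Rightarrow> real" and G\<^sub>1 G\<^sub>2 G\<^sub>3 :: "'a \<Rightarrow> complex"
    and \<omega>\<^sub>0 \<omega>\<^sub>1 \<omega>\<^sub>2 :: real
  assumes weights_nonneg: "\<omega>\<^sub>0 \<ge> 0" "\<omega>\<^sub>1 \<ge> 0" "\<omega>\<^sub>2 \<ge> 0"
    and normalized: "\<omega>\<^sub>0\<^sup>2 + \<omega>\<^sub>1\<^sup>2 + \<omega>\<^sub>2\<^sup>2 = 1"
    and phase_uniform:
      "distributed M lborel \<phi> (\<lambda>x. indicator {0..<2 * pi} x / measure lborel {0..<2 * pi})"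
    and gaussian: "circular_complex_gaussian M G\<^sub>1 1" "circular_complex_gaussian M G\<^sub>2 1"
      "circular_complex_gaussian M G\<^sub>3 1"
    and independent:
      "indep_vars (\<lambda>_. borel)
         (\<lambda>i w. [complex_of_real (\<phi> w), G\<^sub>1 w, G\<^sub>2 w, G\<^sub>3 w] ! i) {..<4::nat}"

definition sosf_gain ::
  "('a \<Rightarrow> real) \<Rightarrow> ('a \<Rightarrow> complex) \<Rightarrow> ('a \<Rightarrow> complex) \<Rightarrow> ('a \<Rightarrow> complex) \<Rightarrow>
   real \<Rightarrow> real \<Rightarrow> real \<Rightarrow> 'a \<Rightarrow> complex" where
  "sosf_gain \<phi> G\<^sub>1 G\<^sub>2 G\<^sub>3 \<omega>\<^sub>0 \<omega>\<^sub>1 \<omega>\<^sub>2 w =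
     complex_of_real \<omega>\<^sub>0 * exp (\<i> * complex_of_real (\<phi> w))
     + complex_of_real \<omega>\<^sub>1 * G\<^sub>1 w + complex_of_real \<omega>\<^sub>2 * G\<^sub>2 w * G\<^sub>3 w"

definition instantaneous_snr :: "('a \<Rightarrow> complex) \<Rightarrow> real \<Rightarrow> 'a \<Rightarrow> real" where
  "instantaneous_snr S gbar w = gbar * (cmod (S w))\<^sup>2"

text \<open>
  The density of the SNR is the Radon-Nikodym derivative of its law. Without any fading (unit
  weight on the specular component) the law is a point mass, and the formal expression
  \<open>f(y) dy\<close> is read as integration against the law itself.
\<close>

definition average_capacity :: "'a measure \<Rightarrow> ('a \<Rightarrow> real) \<Rightarrow> real" where
  "average_capacity M \<gamma> =
     (let \<mu> = distr M borel \<gamma> in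
      if absolutely_continuous lborel \<mu>
      then (LBINT y=0..\<infinity>. log 2 (1 + y) * enn2real (RN_deriv lborel \<mu> y))
      else (LINT y:{0..}|\<mu>. log 2 (1 + y)))"

definition exp_integral_E1 :: "ereal \<Rightarrow> real" where
  "exp_integral_E1 u = (LBINT z=u..\<infinity>. exp (- z) / z)"

text \<open>
  The quotient is taken in the extended reals, where \<open>\<beta> / 0 = \<infinity>\<close> for \<open>\<beta> > 0\<close>, so that a
  vanishing denominator contributes \<open>E1(\<infinity>) = 0\<close>.
\<close>

definition capacity_loss_expr :: "real \<Rightarrow> real \<Rightarrow> real" where
  "capacity_loss_expr \<alpha> \<beta> =
     - log 2 \<beta> - log 2 (exp 1) *
       (LBINT x=0..\<infinity>. exp_integral_E1 (ereal \<beta> / ereal (1 - \<beta> - \<alpha> * (1 - x))) * exp (- x))"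

text \<open>
  For \<open>\<beta> = 0\<close> the limit \<open>b \<rightarrow> 0\<close> is taken with \<open>\<alpha>\<close> fixed as long as \<open>(\<alpha>, b)\<close> is admissible. For
  \<open>\<alpha> < 1\<close> the minimum is eventually \<open>\<alpha>\<close>; it matters only for \<open>\<alpha> = 1\<close>, where no \<open>(1, b)\<close> with
  \<open>b > 0\<close> is admissible and the point \<open>(1, 0)\<close> is approached along \<open>\<alpha> + \<beta> = 1\<close>.
\<close>

definition capacity_loss :: "real \<Rightarrow> real \<Rightarrow> real" where
  "capacity_loss \<alpha> \<beta> =
     (if \<beta> = 0 then Lim (at_right 0) (\<lambda>b. capacity_loss_expr (min \<alpha> (1 - b)) b)
      else capacity_loss_expr \<alpha> \<beta>)"

end

theory Submission
  imports Defs "HOL-Complex_Analysis.Complex_Analysis"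
begin

text \<open>
  The capacity equals the expectation of \<open>log2 (1 + g |S|^2)\<close>. Averaging over the uniform phase first
  replaces \<open>ln (1/g + |S|^2)\<close> by a smooth closed form, a regularised Jensen formula coming from
  the mean value property of \<open>Ln (1 + c z)\<close>; as \<open>g\<close> grows it tends to \<open>ln (max \<beta> |Z|^2)\<close>, where \<open>Z\<close> is
  the diffuse part of \<open>S\<close>. Rotation invariance of Gaussians shows that \<open>|Z|^2\<close> is distributed like
  \<open>((1 - \<alpha> - \<beta>) + \<alpha> X) Y\<close> with \<open>X\<close>, \<open>Y\<close> independent standard exponential variables. A single
  integrable envelope, uniform in \<open>\<alpha>\<close>, \<open>\<beta>\<close> and \<open>g\<close>, justifies both the high-SNR limit and the limit
  \<open>\<beta> \<rightarrow> 0\<close>, and an integration by parts turns the expectation over \<open>Y\<close> into \<open>E1\<close>.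
\<close>

section \<open>Complex Gaussian measure\<close>

text \<open>
  The rotation is factored into two triangular substitutions, each affine in a single coordinate.
\<close>

lemma nn_integral_lborel_rotation:
  fixes f :: "real \<Rightarrow> real \<Rightarrow> ennreal" and c s :: real
  assumes [measurable]: "case_prod f \<in> borel_measurable (borel \<Otimes>\<^sub>M borel)"
    and cs: "c\<^sup>2 + s\<^sup>2 = 1"
  shows "(\<integral>\<^sup>+x. \<integral>\<^sup>+y. f (c * x - s * y) (s * x + c * y) \<partial>lborel \<partial>lborel)
       = (\<integral>\<^sup>+x. \<integral>\<^sup>+y. f x y \<partial>lborel \<partial>lborel)"
proof (cases "c = 0")
  \<comment> \<open>The case \<open>c = 0\<close> is separate because the later substitutions divide
    by \<open>c\<close>; here the map is a swap of coordinates up to sign.\<close>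
  case True
  then have s: "s\<^sup>2 = 1" "s \<noteq> 0" "\<bar>s\<bar> = 1" using cs by (auto simp: power2_eq_1_iff)
  have "(\<integral>\<^sup>+x. \<integral>\<^sup>+y. f x y \<partial>lborel \<partial>lborel) = (\<integral>\<^sup>+x. \<integral>\<^sup>+y. f (- s * x) y \<partial>lborel \<partial>lborel)"
    using s by (subst nn_integral_real_affine[where c="-s" and t=0]) simp_all
  also have "\<dots> = (\<integral>\<^sup>+x. \<integral>\<^sup>+y. f (- s * x) (s * y) \<partial>lborel \<partial>lborel)"
    using s by (subst nn_integral_real_affine[where c=s and t=0]) simp_all
  also have "\<dots> = (\<integral>\<^sup>+y. \<integral>\<^sup>+x. f (- s * x) (s * y) \<partial>lborel \<partial>lborel)"
    by (rule lborel_pair.Fubini') measurable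
  finally show ?thesis using True by simp
next
  case False
  have "(\<integral>\<^sup>+x. \<integral>\<^sup>+y. f (c * x - s * y) (s * x + c * y) \<partial>lborel \<partial>lborel)
      = (\<integral>\<^sup>+y. \<integral>\<^sup>+x. f (c * x - s * y) (s * x + c * y) \<partial>lborel \<partial>lborel)"
    by (rule lborel_pair.Fubini'[symmetric]) measurable
  \<comment> \<open>For fixed \<open>y\<close> the new variable is \<open>u = c * x - s * y\<close>;
    since \<open>c\<^sup>2 + s\<^sup>2 = 1\<close>, the second argument becomes
    \<open>(s * u + y) / c\<close>.\<close>
  also have "\<dots> = (\<integral>\<^sup>+y. \<bar>1/c\<bar> * (\<integral>\<^sup>+u. f u ((s * u + y) / c) \<partial>lborel) \<partial>lborel)"
  proof (rule nn_integral_cong)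
    fix y :: real
    have e: "s * (s * y + u) / c + c * y = (s * u + y) / c" for u
    proof -
      have "y = (c\<^sup>2 + s\<^sup>2) * y" using cs by simp
      then show ?thesis using False by (simp add: field_simps power2_eq_square)
    qed
    show "(\<integral>\<^sup>+x. f (c * x - s * y) (s * x + c * y) \<partial>lborel)
        = \<bar>1/c\<bar> * (\<integral>\<^sup>+u. f u ((s * u + y) / c) \<partial>lborel)"
      using False
      by (subst nn_integral_real_affine[where c="1/c" and t="s * y / c"])
         (simp_all add: add_divide_distrib[symmetric] e)
  qed
  also have "\<dots> = \<bar>1/c\<bar> * (\<integral>\<^sup>+y. \<integral>\<^sup>+u. f u ((s * u + y) / c) \<partial>lborel \<partial>lborel)"
    by (rule nn_integral_cmult) measurable
  also have "\<dots> = \<bar>1/c\<bar> * (\<integral>\<^sup>+u. \<integral>\<^sup>+y. f u ((s * u + y) / c) \<partial>lborel \<partial>lborel)"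
    by (subst lborel_pair.Fubini') simp_all
  \<comment> \<open>Now \<open>u\<close> is fixed and \<open>v = (s * u + y) / c\<close> replaces
    \<open>y\<close>; its Jacobian cancels the first one.\<close>
  also have "\<dots> = \<bar>1/c\<bar> * (\<integral>\<^sup>+u. \<bar>c\<bar> * (\<integral>\<^sup>+v. f u v \<partial>lborel) \<partial>lborel)"
  proof (intro arg_cong2[where f="(*)"] refl nn_integral_cong)
    fix u :: real
    show "(\<integral>\<^sup>+y. f u ((s * u + y) / c) \<partial>lborel) = \<bar>c\<bar> * (\<integral>\<^sup>+v. f u v \<partial>lborel)"
      using False by (subst nn_integral_real_affine[where c=c and t="- s * u"]) simp_all
  qed
  also have "\<dots> = \<bar>1/c\<bar> * (\<bar>c\<bar> * (\<integral>\<^sup>+u. \<integral>\<^sup>+v. f u v \<partial>lborel \<partial>lborel))"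
    by (subst nn_integral_cmult) simp_all
  also have "\<dots> = (\<integral>\<^sup>+u. \<integral>\<^sup>+v. f u v \<partial>lborel \<partial>lborel)"
    using False by (simp add: mult.assoc[symmetric] ennreal_mult'[symmetric] abs_mult[symmetric])
  finally show ?thesis .
qed

section \<open>The normal law of one coordinate and its rotation invariance\<close>

definition half_normal :: "real measure" where
  "half_normal = density lborel (normal_density 0 (sqrt (1 / 2)))"

text \<open>Each coordinate of a complex Gaussian of unit variance has variance 1/2, so the product
  of two such densities depends on x^2 + y^2 alone.\<close>

lemma normal_density_half: "normal_density 0 (sqrt (1 / 2)) x = exp (- x\<^sup>2) / sqrt pi"
  by (simp add: normal_density_def)

lemma sets_half_normal [simp, measurable_cong]: "sets half_normal = sets borel"
  and space_half_normal [simp]: "space half_normal = UNIV"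
  by (simp_all add: half_normal_def)

lemma prob_space_half_normal: "prob_space half_normal"
  unfolding half_normal_def by (rule prob_space_normal_density) simp

interpretation hn: prob_space half_normal by (rule prob_space_half_normal)
interpretation hn2: pair_prob_space half_normal half_normal ..

lemma nn_integral_half_normal:
  assumes [measurable]: "f \<in> borel_measurable borel"
  shows "(\<integral>\<^sup>+x. f x \<partial>half_normal) = (\<integral>\<^sup>+x. ennreal (exp (- x\<^sup>2) / sqrt pi) * f x \<partial>lborel)"
  unfolding half_normal_def by (subst nn_integral_density) (simp_all add: normal_density_half)

lemma nn_integral_half_normal2:
  fixes f :: "real \<Rightarrow> real \<Rightarrow> ennreal"
  assumes [measurable]: "case_prod f \<in> borel_measurable (borel \<Otimes>\<^sub>M borel)"
  shows "(\<integral>\<^sup>+x. \<integral>\<^sup>+y. f x y \<partial>half_normal \<partial>half_normal)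
       = (\<integral>\<^sup>+x. \<integral>\<^sup>+y. ennreal (exp (- (x\<^sup>2 + y\<^sup>2)) / pi) * f x y \<partial>lborel \<partial>lborel)"
proof -
  have "(\<integral>\<^sup>+x. \<integral>\<^sup>+y. f x y \<partial>half_normal \<partial>half_normal)
     = (\<integral>\<^sup>+x. ennreal (exp (- x\<^sup>2) / sqrt pi)
          * (\<integral>\<^sup>+y. ennreal (exp (- y\<^sup>2) / sqrt pi) * f x y \<partial>lborel) \<partial>lborel)"
    by (simp add: nn_integral_half_normal)
  also have "\<dots> = (\<integral>\<^sup>+x. \<integral>\<^sup>+y. ennreal (exp (- x\<^sup>2) / sqrt pi)
          * (ennreal (exp (- y\<^sup>2) / sqrt pi) * f x y) \<partial>lborel \<partial>lborel)"
    by (simp add: nn_integral_cmult)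
  also have "\<dots> = (\<integral>\<^sup>+x. \<integral>\<^sup>+y. ennreal (exp (- (x\<^sup>2 + y\<^sup>2)) / pi) * f x y \<partial>lborel \<partial>lborel)"
    by (intro nn_integral_cong)
       (simp add: mult.assoc[symmetric] ennreal_mult[symmetric] exp_add[symmetric])
  finally show ?thesis .
qed

text \<open>The joint density is a function of x^2 + y^2, which a rotation preserves, so the
  invariance of Lebesgue measure carries over.\<close>

lemma nn_integral_half_normal_rotation:
  fixes f :: "real \<Rightarrow> real \<Rightarrow> ennreal" and c s :: real
  assumes [measurable]: "case_prod f \<in> borel_measurable (borel \<Otimes>\<^sub>M borel)"
    and cs: "c\<^sup>2 + s\<^sup>2 = 1"
  shows "(\<integral>\<^sup>+x. \<integral>\<^sup>+y. f (c * x - s * y) (s * x + c * y) \<partial>half_normal \<partial>half_normal)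
       = (\<integral>\<^sup>+x. \<integral>\<^sup>+y. f x y \<partial>half_normal \<partial>half_normal)"
proof -
  have n: "(c * x - s * y)\<^sup>2 + (s * x + c * y)\<^sup>2 = x\<^sup>2 + y\<^sup>2" for x y
  proof -
    have "(c * x - s * y)\<^sup>2 + (s * x + c * y)\<^sup>2 = (c\<^sup>2 + s\<^sup>2) * (x\<^sup>2 + y\<^sup>2)"
      by (simp add: power2_eq_square algebra_simps)
    then show ?thesis using cs by simp
  qed
  have "(\<integral>\<^sup>+x. \<integral>\<^sup>+y. f (c * x - s * y) (s * x + c * y) \<partial>half_normal \<partial>half_normal)
    = (\<integral>\<^sup>+x. \<integral>\<^sup>+y. ennreal (exp (- (x\<^sup>2 + y\<^sup>2)) / pi)
         * f (c * x - s * y) (s * x + c * y) \<partial>lborel \<partial>lborel)"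
    by (rule nn_integral_half_normal2) measurable
  also have "\<dots> = (\<integral>\<^sup>+x. \<integral>\<^sup>+y. ennreal (exp (- (x\<^sup>2 + y\<^sup>2)) / pi) * f x y \<partial>lborel \<partial>lborel)"
    using nn_integral_lborel_rotation[OF _ cs,
        of "\<lambda>x y. ennreal (exp (- (x\<^sup>2 + y\<^sup>2)) / pi) * f x y"]
    by (simp add: n)
  also have "\<dots> = (\<integral>\<^sup>+x. \<integral>\<^sup>+y. f x y \<partial>half_normal \<partial>half_normal)"
    by (rule nn_integral_half_normal2[symmetric]) measurable
  finally show ?thesis .
qed

text \<open>Stability of centred normals: with q the length of the vector (p, r), the combination p
  x + r y is q times the first coordinate of a rotated pair.\<close>

lemma nn_integral_half_normal_combination:
  fixes h :: "real \<Rightarrow> ennreal" and p r :: real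
  assumes [measurable]: "h \<in> borel_measurable borel"
  shows "(\<integral>\<^sup>+x. \<integral>\<^sup>+y. h (p * x + r * y) \<partial>half_normal \<partial>half_normal)
       = (\<integral>\<^sup>+x. h (sqrt (p\<^sup>2 + r\<^sup>2) * x) \<partial>half_normal)"
proof (cases "p = 0 \<and> r = 0")
  case True
  then show ?thesis by (simp add: hn.emeasure_space_1[simplified])
next
  case False
  define q where "q = sqrt (p\<^sup>2 + r\<^sup>2)"
  have q2: "q\<^sup>2 = p\<^sup>2 + r\<^sup>2" by (simp add: q_def)
  have q: "q \<noteq> 0" using False by (simp add: q_def sum_power2_eq_zero_iff)
  have "(\<integral>\<^sup>+x. \<integral>\<^sup>+y. h (q * ((p / q) * x - (- r / q) * y)) \<partial>half_normal \<partial>half_normal)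
    = (\<integral>\<^sup>+x. \<integral>\<^sup>+y. h (q * x) \<partial>half_normal \<partial>half_normal)"
    using q q2 by (intro nn_integral_half_normal_rotation[where f="\<lambda>x y. h (q * x)" and c="p/q" and s="-r/q"])
      (auto simp: power_divide add_divide_distrib[symmetric])
  then show ?thesis using q
    by (simp add: hn.emeasure_space_1[simplified] distrib_left q_def[symmetric])
qed

section \<open>The standard circular complex Gaussian law and its linear combinations\<close>

definition complex_gauss :: "complex measure" where
  "complex_gauss = distr (half_normal \<Otimes>\<^sub>M half_normal) borel (\<lambda>(x, y). Complex x y)"

lemma measurable_Complex [measurable]:
  "f \<in> borel_measurable M \<Longrightarrow> g \<in> borel_measurable M \<Longrightarrow> (\<lambda>x. Complex (f x) (g x)) \<in> borel_measurable M"
  by (simp add: Complex_eq)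

lemma Complex_mult_eq: "u * Complex x y = Complex (Re u * x - Im u * y) (Im u * x + Re u * y)"
  by (simp add: complex_eq_iff)

lemma sets_complex_gauss [simp, measurable_cong]: "sets complex_gauss = sets borel"
  and space_complex_gauss [simp]: "space complex_gauss = UNIV"
  by (simp_all add: complex_gauss_def)

lemma prob_space_complex_gauss: "prob_space complex_gauss"
  unfolding complex_gauss_def by (intro hn2.prob_space_distr) measurable

interpretation cg: prob_space complex_gauss by (rule prob_space_complex_gauss)

lemma nn_integral_complex_gauss:
  assumes [measurable]: "f \<in> borel_measurable borel"
  shows "(\<integral>\<^sup>+z. f z \<partial>complex_gauss) = (\<integral>\<^sup>+x. \<integral>\<^sup>+y. f (Complex x y) \<partial>half_normal \<partial>half_normal)"
  unfolding complex_gauss_def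
  by (subst nn_integral_distr, measurable)
     (subst hn.nn_integral_fst[symmetric], simp_all)

text \<open>Multiplication by a unit complex number is the planar rotation with
  \<open>c = Re u\<close> and \<open>s = Im u\<close>.\<close>

lemma nn_integral_complex_gauss_rotation:
  assumes [measurable]: "f \<in> borel_measurable borel" and u: "cmod u = 1"
  shows "(\<integral>\<^sup>+z. f (u * z) \<partial>complex_gauss) = (\<integral>\<^sup>+z. f z \<partial>complex_gauss)"
proof -
  have "(Re u)\<^sup>2 + (Im u)\<^sup>2 = 1" using u by (metis cmod_power2 one_power2)
  then show ?thesis
    using nn_integral_half_normal_rotation[of "\<lambda>x y. f (Complex x y)" "Re u" "Im u"]
    by (simp add: nn_integral_complex_gauss Complex_mult_eq)
qed

text \<open>Real coefficients do not mix real and imaginary parts. Once the two middle integrals are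
  exchanged, the combination rule for real normals applies to each coordinate separately.\<close>

lemma nn_integral_complex_gauss_real_combination:
  fixes p r :: real
  assumes [measurable]: "f \<in> borel_measurable borel"
  shows "(\<integral>\<^sup>+z. \<integral>\<^sup>+w. f (of_real p * z + of_real r * w) \<partial>complex_gauss \<partial>complex_gauss)
       = (\<integral>\<^sup>+z. f (of_real (sqrt (p\<^sup>2 + r\<^sup>2)) * z) \<partial>complex_gauss)"
proof -
  define q where "q = sqrt (p\<^sup>2 + r\<^sup>2)"
  have "(\<integral>\<^sup>+z. \<integral>\<^sup>+w. f (of_real p * z + of_real r * w) \<partial>complex_gauss \<partial>complex_gauss)
    = (\<integral>\<^sup>+x. \<integral>\<^sup>+y. \<integral>\<^sup>+x'. \<integral>\<^sup>+y'. f (Complex (p * x + r * x') (p * y + r * y'))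
        \<partial>half_normal \<partial>half_normal \<partial>half_normal \<partial>half_normal)"
    by (simp add: nn_integral_complex_gauss Complex_mult_eq complex_add)
  also have "\<dots> = (\<integral>\<^sup>+x. \<integral>\<^sup>+x'. \<integral>\<^sup>+y. \<integral>\<^sup>+y'. f (Complex (p * x + r * x') (p * y + r * y'))
        \<partial>half_normal \<partial>half_normal \<partial>half_normal \<partial>half_normal)"
    by (intro nn_integral_cong hn2.Fubini') measurable
  also have "\<dots> = (\<integral>\<^sup>+x. \<integral>\<^sup>+x'. \<integral>\<^sup>+y. f (Complex (p * x + r * x') (q * y))
        \<partial>half_normal \<partial>half_normal \<partial>half_normal)"
    unfolding q_def by (intro nn_integral_cong nn_integral_half_normal_combination) measurable
  also have "\<dots> = (\<integral>\<^sup>+x. \<integral>\<^sup>+y. f (Complex (q * x) (q * y)) \<partial>half_normal \<partial>half_normal)"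
    unfolding q_def
    by (rule nn_integral_half_normal_combination[where h="\<lambda>t. \<integral>\<^sup>+y. f (Complex t (sqrt (p\<^sup>2 + r\<^sup>2) * y)) \<partial>half_normal"])
       measurable
  also have "\<dots> = (\<integral>\<^sup>+z. f (of_real q * z) \<partial>complex_gauss)"
    by (simp add: nn_integral_complex_gauss complex_of_real_mult_Complex)
  finally show ?thesis unfolding q_def .
qed

text \<open>Rotation invariance absorbs the argument of \<open>w\<close>, which reduces to real
  coefficients. With \<open>w\<close> a multiple of a fixed value of \<open>G\<^sub>3\<close>, this
  merges the two diffuse terms of the channel into one Gaussian.\<close>

lemma nn_integral_complex_gauss_combination:
  fixes p :: real and w :: complex
  assumes [measurable]: "f \<in> borel_measurable borel"
  shows "(\<integral>\<^sup>+z. \<integral>\<^sup>+z'. f (of_real p * z' + w * z) \<partial>complex_gauss \<partial>complex_gauss)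
       = (\<integral>\<^sup>+z. f (of_real (sqrt (p\<^sup>2 + (cmod w)\<^sup>2)) * z) \<partial>complex_gauss)"
proof -
  \<comment> \<open>The unit phase factor of \<open>w\<close>; for \<open>w = 0\<close> any unit
    number serves.\<close>
  define u where "u = (if w = 0 then 1 else w / of_real (cmod w))"
  have u: "cmod u = 1" "w = of_real (cmod w) * u" by (auto simp: u_def norm_divide)
  let ?F = "\<lambda>z. \<integral>\<^sup>+z'. f (of_real p * z' + of_real (cmod w) * z) \<partial>complex_gauss"
  have "(\<integral>\<^sup>+z. \<integral>\<^sup>+z'. f (of_real p * z' + w * z) \<partial>complex_gauss \<partial>complex_gauss)
    = (\<integral>\<^sup>+z. ?F (u * z) \<partial>complex_gauss)"
    by (subst u(2)) (simp add: mult.assoc)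
  also have "\<dots> = (\<integral>\<^sup>+z. ?F z \<partial>complex_gauss)"
    by (rule nn_integral_complex_gauss_rotation[OF _ u(1)]) measurable
  also have "\<dots> = (\<integral>\<^sup>+z. f (of_real (sqrt ((cmod w)\<^sup>2 + p\<^sup>2)) * z) \<partial>complex_gauss)"
    by (subst nn_integral_complex_gauss_real_combination[symmetric]) (simp_all add: add.commute)
  finally show ?thesis by (simp add: add.commute)
qed

section \<open>Polar integration and the law of the squared modulus\<close>

lemma nn_integral_even_function:
  fixes f :: "real \<Rightarrow> ennreal"
  assumes [measurable]: "f \<in> borel_measurable borel" and even: "\<And>x. f (- x) = f x"
  shows "(\<integral>\<^sup>+x. f x \<partial>lborel) = 2 * (\<integral>\<^sup>+x. f x * indicator {0..} x \<partial>lborel)"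
proof -
  have "(\<integral>\<^sup>+x. f x \<partial>lborel) = (\<integral>\<^sup>+x. f x * indicator {0..} x + f x * indicator {..<0} x \<partial>lborel)"
    by (intro nn_integral_cong) (auto split: split_indicator)
  also have "\<dots> = (\<integral>\<^sup>+x. f x * indicator {0..} x \<partial>lborel) + (\<integral>\<^sup>+x. f x * indicator {..<0} x \<partial>lborel)"
    by (rule nn_integral_add) measurable
  also have "(\<integral>\<^sup>+x. f x * indicator {..<0} x \<partial>lborel) = (\<integral>\<^sup>+x. f x * indicator {..<0} (- x) \<partial>lborel)"
    by (subst nn_integral_real_affine[where c="-1" and t=0]) (simp_all add: even)
  also have "\<dots> = (\<integral>\<^sup>+x. f x * indicator {0..} x \<partial>lborel)"
    using AE_lborel_singleton[of "0::real"]
    by (intro nn_integral_cong_AE) (auto split: split_indicator)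
  finally show ?thesis by (simp add: mult_2)
qed

text \<open>The substitution is \<open>y = x s\<close>.\<close>

lemma nn_integral_lborel_polar:
  fixes k :: "real \<Rightarrow> ennreal"
  assumes [measurable]: "k \<in> borel_measurable borel"
  shows "(\<integral>\<^sup>+x. \<integral>\<^sup>+y. k (x\<^sup>2 + y\<^sup>2) \<partial>lborel \<partial>lborel)
       = (\<integral>\<^sup>+s. 2 * (\<integral>\<^sup>+x. ennreal x * k (x\<^sup>2 * (1 + s\<^sup>2)) * indicator {0..} x \<partial>lborel) \<partial>lborel)"
proof -
  have "(\<integral>\<^sup>+x. \<integral>\<^sup>+y. k (x\<^sup>2 + y\<^sup>2) \<partial>lborel \<partial>lborel)
    = (\<integral>\<^sup>+x. \<integral>\<^sup>+s. ennreal \<bar>x\<bar> * k (x\<^sup>2 * (1 + s\<^sup>2)) \<partial>lborel \<partial>lborel)"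
  proof (rule nn_integral_cong_AE)
    have "(\<integral>\<^sup>+y. k (x\<^sup>2 + y\<^sup>2) \<partial>lborel) = (\<integral>\<^sup>+s. ennreal \<bar>x\<bar> * k (x\<^sup>2 * (1 + s\<^sup>2)) \<partial>lborel)"
      if "x \<noteq> 0" for x
      using that by (subst nn_integral_real_affine[where c=x and t=0])
        (simp_all add: nn_integral_cmult power_mult_distrib distrib_left)
    moreover have "AE x in lborel. x \<noteq> (0::real)" by (rule AE_lborel_singleton)
    ultimately show "AE x in lborel. (\<integral>\<^sup>+y. k (x\<^sup>2 + y\<^sup>2) \<partial>lborel)
        = (\<integral>\<^sup>+s. ennreal \<bar>x\<bar> * k (x\<^sup>2 * (1 + s\<^sup>2)) \<partial>lborel)"
      by auto
  qed
  also have "\<dots> = (\<integral>\<^sup>+s. \<integral>\<^sup>+x. ennreal \<bar>x\<bar> * k (x\<^sup>2 * (1 + s\<^sup>2)) \<partial>lborel \<partial>lborel)"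
    by (rule lborel_pair.Fubini') measurable
  also have "\<dots> = (\<integral>\<^sup>+s. 2 * (\<integral>\<^sup>+x. ennreal \<bar>x\<bar> * k (x\<^sup>2 * (1 + s\<^sup>2)) * indicator {0..} x \<partial>lborel) \<partial>lborel)"
    by (intro nn_integral_cong nn_integral_even_function) simp_all
  also have "\<dots> = (\<integral>\<^sup>+s. 2 * (\<integral>\<^sup>+x. ennreal x * k (x\<^sup>2 * (1 + s\<^sup>2)) * indicator {0..} x \<partial>lborel) \<partial>lborel)"
    by (intro nn_integral_cong arg_cong[where f="(*) 2"]) (simp split: split_indicator)
  finally show ?thesis .
qed

text \<open>The distribution function is computed in the coordinates \<open>x\<close> and slope
  \<open>s = y / x\<close>. The integral over \<open>x\<close> is elementary and leaves a multiple
  of 1 / (1 + s^2), whose integral over the line is pi.\<close>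

lemma distributed_cmod_square_complex_gauss:
  "distributed complex_gauss lborel (\<lambda>z. (cmod z)\<^sup>2) (exponential_density 1)"
proof (subst cg.exponential_distributed_iff, simp, intro conjI allI impI)
  fix a :: real assume a: "0 \<le> a"
  define k where "k u = ennreal (exp (- u) / pi) * indicator {..a} u" for u
  have [measurable]: "k \<in> borel_measurable borel" unfolding k_def by measurable
  have inner: "2 * (\<integral>\<^sup>+x. ennreal x * k (x\<^sup>2 * (1 + s\<^sup>2)) * indicator {0..} x \<partial>lborel)
    = ennreal ((1 - exp (- a)) / pi) * ennreal (inverse (1 + s\<^sup>2))" for s
  proof -
    define d where "d = 1 + s\<^sup>2"
    have d: "d > 0" by (simp add: d_def add_pos_nonneg)
    \<comment> \<open>The bound on \<open>x\<close> at which the constraint x^2 (1 + s^2) \<le> a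
      becomes an equality.\<close>
    define b where "b = sqrt (a / d)"
    have b: "b \<ge> 0" "b\<^sup>2 * d = a" using a d by (auto simp: b_def)
    have iff: "x\<^sup>2 * d \<le> a \<longleftrightarrow> x \<le> b" if "x \<ge> 0" for x
    proof -
      have "x\<^sup>2 * d \<le> a \<longleftrightarrow> x\<^sup>2 * d \<le> b\<^sup>2 * d" using b by simp
      also have "\<dots> \<longleftrightarrow> x\<^sup>2 \<le> b\<^sup>2" using d by simp
      also have "\<dots> \<longleftrightarrow> x \<le> b" using that b by (simp add: abs_le_square_iff[symmetric])
      finally show ?thesis .
    qed
    have "2 * (\<integral>\<^sup>+x. ennreal x * k (x\<^sup>2 * d) * indicator {0..} x \<partial>lborel)
      = 2 * (\<integral>\<^sup>+x. ennreal (x * (exp (- (x\<^sup>2 * d)) / pi)) * indicator {0..b} x \<partial>lborel)"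
    proof (intro arg_cong[where f="(*) 2"] nn_integral_cong)
      fix x :: real
      show "ennreal x * k (x\<^sup>2 * d) * indicator {0..} x
        = ennreal (x * (exp (- (x\<^sup>2 * d)) / pi)) * indicator {0..b} x"
      proof (cases "0 \<le> x")
        case True
        then show ?thesis using iff[OF True]
          by (cases "x \<le> b") (simp_all add: k_def ennreal_mult'[OF True, symmetric])
      qed simp
    qed
    \<comment> \<open>The antiderivative is - exp (- x^2 d) / (2 d pi).\<close>
    also have "(\<integral>\<^sup>+x. ennreal (x * (exp (- (x\<^sup>2 * d)) / pi)) * indicator {0..b} x \<partial>lborel)
      = ennreal (- exp (- (b\<^sup>2 * d)) / (2 * d * pi) - (- exp (- (0\<^sup>2 * d)) / (2 * d * pi)))"
      using b d by (intro nn_integral_FTC_Icc)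
        (auto intro!: derivative_eq_intros simp: field_simps has_real_derivative_iff_has_vector_derivative[symmetric])
    also have "2 * \<dots> = ennreal (2 * (- exp (- (b\<^sup>2 * d)) / (2 * d * pi) - (- exp (- (0\<^sup>2 * d)) / (2 * d * pi))))"
      using a b d by (subst ennreal_mult) (auto simp: field_simps)
    also have "\<dots> = ennreal ((1 - exp (- a)) / pi * inverse d)"
      using b d by (intro arg_cong[where f=ennreal]) (simp add: field_simps)
    also have "\<dots> = ennreal ((1 - exp (- a)) / pi) * ennreal (inverse d)"
      using a d by (subst ennreal_mult) auto
    finally show ?thesis unfolding d_def .
  qed
  have arctan: "(\<integral>\<^sup>+s. ennreal (inverse (1 + s\<^sup>2)) \<partial>lborel) = ennreal pi"
  proof -
    have "integrable lborel (\<lambda>x::real. inverse (1 + x\<^sup>2))"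
      using integrable_inverse_1_plus_square by (simp add: set_integrable_def)
    then show ?thesis
      using LBINT_inverse_1_plus_square
      by (subst nn_integral_eq_integral)
         (auto simp: interval_lebesgue_integral_def set_lebesgue_integral_def)
  qed
  have "emeasure complex_gauss {z \<in> space complex_gauss. (cmod z)\<^sup>2 \<le> a}
    = (\<integral>\<^sup>+z. indicator {..a} ((cmod z)\<^sup>2) \<partial>complex_gauss)"
  proof -
    have "emeasure complex_gauss {z \<in> space complex_gauss. (cmod z)\<^sup>2 \<le> a}
      = (\<integral>\<^sup>+z. indicator {z \<in> space complex_gauss. (cmod z)\<^sup>2 \<le> a} z \<partial>complex_gauss)"
      by (rule nn_integral_indicator[symmetric]) measurable
    also have "\<dots> = (\<integral>\<^sup>+z. indicator {..a} ((cmod z)\<^sup>2) \<partial>complex_gauss)"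
      by (intro nn_integral_cong) (simp split: split_indicator)
    finally show ?thesis .
  qed
  also have "\<dots> = (\<integral>\<^sup>+x. \<integral>\<^sup>+y. k (x\<^sup>2 + y\<^sup>2) \<partial>lborel \<partial>lborel)"
    by (simp add: nn_integral_complex_gauss nn_integral_half_normal2 k_def cmod_power2)
  also have "\<dots> = ennreal ((1 - exp (- a)) / pi) * ennreal pi"
    by (simp add: nn_integral_lborel_polar inner nn_integral_cmult arctan)
  also have "\<dots> = ennreal (1 - exp (- a))"
    using a by (simp add: ennreal_mult[symmetric])
  finally show "cg.prob {z \<in> space complex_gauss. (cmod z)\<^sup>2 \<le> a} = 1 - exp (- a * 1)"
    using a by (simp add: measure_def)
qed measurable

section \<open>The standard exponential law\<close>

definition exponential_measure :: "real measure" where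
  "exponential_measure = density lborel (exponential_density 1)"

lemma prob_space_exponential_measure: "prob_space exponential_measure"
  unfolding exponential_measure_def by (rule prob_space_exponential_density) simp

interpretation ex: prob_space exponential_measure by (rule prob_space_exponential_measure)
interpretation ex2: pair_prob_space exponential_measure exponential_measure ..

lemma sets_exponential_measure [simp, measurable_cong]: "sets exponential_measure = sets borel"
  and space_exponential_measure [simp]: "space exponential_measure = UNIV"
  by (simp_all add: exponential_measure_def)

lemma nn_integral_complex_gauss_cmod_square:
  assumes [measurable]: "h \<in> borel_measurable borel"
  shows "(\<integral>\<^sup>+z. h ((cmod z)\<^sup>2) \<partial>complex_gauss) = (\<integral>\<^sup>+x. h x \<partial>exponential_measure)"
proof -
  have "exponential_measure = distr complex_gauss lborel (\<lambda>z. (cmod z)\<^sup>2)"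
    unfolding exponential_measure_def
    using distributed_distr_eq_density[OF distributed_cmod_square_complex_gauss] by simp
  then show ?thesis by (subst \<open>exponential_measure = _\<close>) (subst nn_integral_distr, simp_all add: exponential_measure_def)
qed

section \<open>Averaging over the phase\<close>

text \<open>Cauchy's formula at the centre: the kernel 1 / u cancels against the derivative of
  \<open>cis t\<close>, up to the imaginary unit.\<close>

lemma has_integral_circle_mean:
  fixes f :: "complex \<Rightarrow> complex"
  assumes "f holomorphic_on cball 0 1"
  shows "((\<lambda>t. f (cis t)) has_integral 2 * pi * f 0) {0..2 * pi}"
proof -
  have "((\<lambda>u. f u / (u - 0)) has_contour_integral (2 * of_real pi * \<i> * f 0)) (circlepath 0 1)"
    by (rule Cauchy_integral_circlepath_simple) (use assms in auto)
  then have "((\<lambda>t. f (cis t) * \<i>) has_integral 2 * of_real pi * \<i> * f 0) {0..2 * pi}"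
    by (simp add: circlepath_def has_contour_integral_part_circlepath_iff)
  from has_integral_mult_left[OF this, of "- \<i>"] show ?thesis
    by (simp add: mult_ac)
qed

text \<open>For |c| < 1 the values 1 + c w stay in the right half-plane on the closed disc, so Ln (1
  + c w) is holomorphic there and vanishes at the centre. Its real part ln |1 + c w| therefore has
  mean 0 on the circle, and only \<open>ln K\<close> remains.\<close>

lemma has_integral_ln_cmod_circle:
  assumes c: "cmod c < 1" and K: "0 < K"
  shows "((\<lambda>t. ln (K * (cmod (1 + c * cis t))\<^sup>2)) has_integral 2 * pi * ln K) {0..2 * pi}"
proof -
  have lt: "cmod (c * w) < 1" if "cmod w \<le> 1" for w
    using mult_left_mono[OF that, of "cmod c"] c by (simp add: norm_mult)
  have re: "0 < Re (1 + c * w)" if "cmod w \<le> 1" for w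
    using lt[OF that] abs_Re_le_cmod[of "c * w"] by (simp only: plus_complex.sel one_complex.sel)
  have nz: "1 + c * cis t \<noteq> 0" for t
    using re[of "cis t"] by (metis less_irrefl norm_cis order_refl zero_complex.sel(1))
  have "(\<lambda>w. Ln (1 + c * w)) holomorphic_on cball 0 1"
  proof (intro holomorphic_intros)
    fix w :: complex assume "w \<in> cball 0 1"
    with re[of w] show "1 + c * w \<notin> \<real>\<^sub>\<le>\<^sub>0" by (simp add: complex_nonpos_Reals_iff)
  qed
  from has_integral_Re[OF has_integral_circle_mean[OF this]]
  have "((\<lambda>t. ln (cmod (1 + c * cis t))) has_integral 0) {0..2 * pi}"
    by (simp add: nz)
  from has_integral_add[OF has_integral_const_real[of "ln K" 0 "2 * pi"] has_integral_mult_right[OF this, of 2]]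
  show ?thesis using K nz by (simp add: ln_mult ln_realpow mult.commute)
qed

lemma cmod_add_power2: "(cmod (x + y))\<^sup>2 = (cmod x)\<^sup>2 + (cmod y)\<^sup>2 + 2 * Re (x * cnj y)"
  by (simp only: cmod_power2) (simp add: power2_eq_square algebra_simps)

text \<open>
  The larger root \<open>K\<close> of \<open>K^2 - (d + b + r) K + b r = 0\<close>: with \<open>b = a^2\<close>, \<open>r = |z|^2\<close> and \<open>c = a cnj z / K\<close> one
  has \<open>d + |a w + z|^2 = K |1 + c w|^2\<close> on the unit circle, and \<open>|c| < 1\<close> if \<open>d > 0\<close>.
\<close>

definition phase_mean :: "real \<Rightarrow> real \<Rightarrow> real \<Rightarrow> real" where
  "phase_mean d b r = (d + b + r + sqrt ((d + b + r)\<^sup>2 - 4 * b * r)) / 2"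

text \<open>Everything follows from the form (b - r)^2 + d (d + 2 (b + r)) of the discriminant. The
  first two bounds serve the envelope, the equation and the strict bounds serve the factorisation on
  the circle, and \<open>d \<le> phase_mean d b r\<close> keeps the averaged logarithm
  nonnegative.\<close>

lemma phase_mean_props:
  assumes "0 \<le> d" "0 \<le> b" "0 \<le> r"
  shows "max b r \<le> phase_mean d b r" "phase_mean d b r \<le> d + b + r"
    "(phase_mean d b r)\<^sup>2 + b * r = (d + b + r) * phase_mean d b r"
    "d \<le> phase_mean d b r"
    "0 < d \<Longrightarrow> b * r < (phase_mean d b r)\<^sup>2" "0 < d \<Longrightarrow> 0 < phase_mean d b r"
proof -
  define D where "D = (d + b + r)\<^sup>2 - 4 * b * r"
  have D: "D = (b - r)\<^sup>2 + d * (d + 2 * (b + r))" by (simp add: D_def power2_eq_square algebra_simps)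
  have D1: "(b - r)\<^sup>2 \<le> D" using assms by (simp add: D)
  then have D0: "0 \<le> D" by (rule order_trans[OF zero_le_power2])
  have K: "phase_mean d b r = (d + b + r + sqrt D) / 2" by (simp add: phase_mean_def D_def)
  have "\<bar>b - r\<bar> \<le> sqrt D" using D1 by (metis real_sqrt_abs real_sqrt_le_iff)
  then show m: "max b r \<le> phase_mean d b r" using assms unfolding K by (simp add: max_def) linarith
  have "sqrt D \<le> d + b + r" by (rule real_le_lsqrt) (use assms in \<open>auto simp: D_def\<close>)
  then show "phase_mean d b r \<le> d + b + r" unfolding K by simp
  show dl: "d \<le> phase_mean d b r"
  proof (cases "d \<le> b + r")
    case True
    moreover obtain q where "sqrt D = q" "0 \<le> q" using D0 by simp
    ultimately show ?thesis unfolding K by simp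
  next
    case False
    \<comment> \<open>As D - (d - b - r)^2 = 4 (d (b + r) - b r), it is enough to bound b r by d (b
      + r).\<close>
    have "(b + r) * (b + r) \<le> d * (b + r)" using False assms by (intro mult_right_mono) auto
    moreover have "0 \<le> b * r" "0 \<le> b * b" "0 \<le> r * r" using assms by simp_all
    ultimately have "b * r \<le> d * (b + r)" by (simp only: distrib_left distrib_right mult.commute[of r b])
    then have "(d - b - r)\<^sup>2 \<le> D" by (simp add: D_def power2_eq_square algebra_simps)
    then have "d - b - r \<le> sqrt D" by (rule real_le_rsqrt)
    then show ?thesis unfolding K by simp
  qed
  have sD: "sqrt D * sqrt D = D" using D0 by simp
  have "4 * ((phase_mean d b r)\<^sup>2 + b * r) = (d + b + r)\<^sup>2 + 2 * (d + b + r) * sqrt D + sqrt D * sqrt D + 4 * b * r"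
    unfolding K by (simp add: power2_eq_square field_simps)
  also have "\<dots> = 4 * ((d + b + r) * phase_mean d b r)"
    unfolding sD unfolding K D_def by (simp add: power2_eq_square field_simps)
  finally show eq: "(phase_mean d b r)\<^sup>2 + b * r = (d + b + r) * phase_mean d b r" by simp
  assume d: "0 < d"
  then show "0 < phase_mean d b r" using dl by linarith
  have "0 < d + 2 * (b + r)" using d assms by (intro add_pos_nonneg) auto
  then have "0 < D" unfolding D by (rule add_nonneg_pos[OF zero_le_power2 mult_pos_pos[OF d]])
  \<comment> \<open>With a positive discriminant the value exceeds half the sum of the roots, hence
    also the other root, which is b r divided by it.\<close>
  then have "d + b + r < 2 * phase_mean d b r" unfolding K by simp
  with eq \<open>0 < phase_mean d b r\<close>
  have "(phase_mean d b r)\<^sup>2 + b * r < 2 * phase_mean d b r * phase_mean d b r"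
    by simp
  then show "b * r < (phase_mean d b r)\<^sup>2" by (simp add: power2_eq_square)
qed

lemma has_integral_ln_phase:
  assumes d: "0 < d" and a: "0 \<le> a"
  shows "((\<lambda>t. ln (d + (cmod (of_real a * cis t + z))\<^sup>2)) has_integral
    2 * pi * ln (phase_mean d (a\<^sup>2) ((cmod z)\<^sup>2))) {0..2 * pi}"
proof -
  define K where "K = phase_mean d (a\<^sup>2) ((cmod z)\<^sup>2)"
  note P = phase_mean_props[of d "a\<^sup>2" "(cmod z)\<^sup>2", folded K_def]
  have K: "0 < K" "(a * cmod z)\<^sup>2 < K\<^sup>2" "K\<^sup>2 + a\<^sup>2 * (cmod z)\<^sup>2 = (d + a\<^sup>2 + (cmod z)\<^sup>2) * K"
    using P(3,5,6) d by (auto simp: power_mult_distrib)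
  define c where "c = of_real a * cnj z / of_real K"
  have cm: "cmod c = a * cmod z / K" using K a by (simp add: c_def norm_mult norm_divide)
  have "a * cmod z < K" using K(1,2) by (simp add: power_less_imp_less_base)
  then have c: "cmod c < 1" using K by (simp add: cm)
  \<comment> \<open>Both squares are expanded. The cross terms agree by the choice of
    \<open>c\<close>, the constant terms by the quadratic equation divided by
    \<open>K\<close>.\<close>
  have "K * (cmod (1 + c * cis t))\<^sup>2 = d + (cmod (of_real a * cis t + z))\<^sup>2" for t
  proof -
    define R where "R = Re (c * cis t)"
    have "(cmod (1 + c * cis t))\<^sup>2 = 1 + (cmod c)\<^sup>2 + 2 * R"
      by (simp only: cmod_add_power2) (simp add: norm_mult R_def)
    moreover have "(cmod (of_real a * cis t + z))\<^sup>2 = a\<^sup>2 + (cmod z)\<^sup>2 + 2 * (K * R)"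
      using K(1) by (simp only: cmod_add_power2 R_def c_def) (simp add: norm_mult field_simps)
    moreover have "K * (cmod c)\<^sup>2 + K = d + a\<^sup>2 + (cmod z)\<^sup>2"
      using K by (simp add: cm power_divide power_mult_distrib field_simps power2_eq_square)
    ultimately show ?thesis by (simp add: distrib_left)
  qed
  with has_integral_ln_cmod_circle[OF c K(1)] show ?thesis by (simp add: K_def)
qed

text \<open>Factoring \<open>g\<close> out of the logarithm leaves the phase average with
  \<open>d = 1 / g\<close>.\<close>

lemma nn_integral_phase:
  assumes g: "0 < g" and a: "0 \<le> a"
  shows "(\<integral>\<^sup>+t. ennreal (indicator {0..<2 * pi} t / (2 * pi)) *
      ennreal (ln (1 + g * (cmod (of_real a * cis t + z))\<^sup>2)) \<partial>lborel)
    = ennreal (ln g + ln (phase_mean (1 / g) (a\<^sup>2) ((cmod z)\<^sup>2)))"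
proof -
  have [measurable]: "cis \<in> borel_measurable borel"
    by (intro borel_measurable_continuous_onI continuous_intros)
  let ?h = "\<lambda>t. ln (1 + g * (cmod (of_real a * cis t + z))\<^sup>2)"
  have "?h t = ln g + ln (1 / g + (cmod (of_real a * cis t + z))\<^sup>2)" for t
    using g by (subst ln_mult_pos[symmetric]) (auto simp: distrib_left add_pos_nonneg)
  then have "(?h has_integral (2 * pi * ln g + 2 * pi * ln (phase_mean (1 / g) (a\<^sup>2) ((cmod z)\<^sup>2)))) {0..2 * pi}"
    using has_integral_add[OF has_integral_const_real[of "ln g" 0 "2 * pi"] has_integral_ln_phase[of "1/g" a z]] g a
    by simp
  from has_integral_mult_right[OF this, of "1 / (2 * pi)"]
  have *: "((\<lambda>t. 1 / (2 * pi) * ?h t) has_integral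
      (ln g + ln (phase_mean (1 / g) (a\<^sup>2) ((cmod z)\<^sup>2)))) {0..2 * pi}"
    by (simp add: add_divide_distrib distrib_left)
  \<comment> \<open>The phase lives on a half-open interval and the circle integral on the closed
    one; the endpoint is a null set.\<close>
  have "(\<integral>\<^sup>+t. ennreal (indicator {0..<2 * pi} t / (2 * pi)) * ennreal (?h t) \<partial>lborel)
    = (\<integral>\<^sup>+t. ennreal (if t \<in> {0..2 * pi} then 1 / (2 * pi) * ?h t else 0) \<partial>lborel)"
    using AE_lborel_singleton[of "2 * pi"]
    by (intro nn_integral_cong_AE, eventually_elim)
       (auto simp: ennreal_mult'[symmetric] split: split_indicator)
  also have "\<dots> = ennreal (ln g + ln (phase_mean (1 / g) (a\<^sup>2) ((cmod z)\<^sup>2)))"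
    using g by (intro nn_integral_has_integral_lborel has_integral_restrict_UNIV[THEN iffD2] *)
      (auto intro!: mult_nonneg_nonneg ln_ge_zero simp: cis_conv_exp)
  finally show ?thesis .
qed

section \<open>Expectations over exponential variables\<close>

lemma AE_exponential_measure_pos: "AE x in exponential_measure. 0 < x"
  unfolding exponential_measure_def using AE_lborel_singleton[of "0::real"]
  by (subst AE_density) (auto simp: exponential_density_def)

lemma AE_exponential_measure2_pos:
  "AE p in exponential_measure \<Otimes>\<^sub>M exponential_measure. 0 < fst p \<and> 0 < snd p"
proof (rule ex2.AE_pair_measure)
  show "{p \<in> space (exponential_measure \<Otimes>\<^sub>M exponential_measure). 0 < fst p \<and> 0 < snd p}
      \<in> sets (exponential_measure \<Otimes>\<^sub>M exponential_measure)" by measurable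
  show "AE x in exponential_measure. AE y in exponential_measure. 0 < fst (x, y) \<and> 0 < snd (x, y)"
    using AE_exponential_measure_pos by eventually_elim (simp add: AE_exponential_measure_pos)
qed

lemma exponential_measure_id:
  "integrable exponential_measure (\<lambda>x. x)" "(\<integral>x. x \<partial>exponential_measure) = 1"
proof -
  have "distributed exponential_measure lborel (\<lambda>x. x) (exponential_density 1)"
    unfolding distributed_def exponential_measure_def
    by (simp add: distr_id2)
  from ex.has_bochner_integral_erlang_ith_moment[OF zero_less_one this, of 1]
  have "has_bochner_integral exponential_measure (\<lambda>x. x) 1" by simp
  then show "integrable exponential_measure (\<lambda>x. x)" "(\<integral>x. x \<partial>exponential_measure) = 1"
    by (simp_all add: has_bochner_integral_iff)
qed

text \<open>Both cases use ln t \<le> t - 1. Below 1 it is applied to t = x^(-1/2), which trades the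
  logarithmic singularity at 0 for an integrable power.\<close>

lemma abs_ln_le: "\<bar>ln x\<bar> \<le> x + 2 * x powr (- 1 / 2)" if "0 < x" for x :: real
proof (cases "1 \<le> x")
  case True
  then show ?thesis using ln_le_minus_one[OF that] powr_ge_zero[of x "- 1 / 2"]
    by (simp only: abs_of_nonneg ln_ge_zero)
next
  case False
  have "- ln x / 2 = ln (x powr (- 1 / 2))" using that by (simp add: ln_powr)
  also have "\<dots> \<le> x powr (- 1 / 2)" using ln_le_minus_one[of "x powr (- 1 / 2)"] that by simp
  finally show ?thesis using False that by simp
qed

text \<open>The dominating function has finite mean: x is integrable, and x^(-1/2) has mean Gamma
  (1/2).\<close>

lemma integrable_exponential_measure_abs_ln: "integrable exponential_measure (\<lambda>x. \<bar>ln x\<bar>)"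
proof (rule Bochner_Integration.integrable_bound)
  have "(\<integral>\<^sup>+x. ennreal (x powr (- 1 / 2)) \<partial>exponential_measure)
      = (\<integral>\<^sup>+t. ennreal (indicator {0..} t * t powr (1 / 2 - 1) / exp t) \<partial>lborel)"
    unfolding exponential_measure_def
    by (subst nn_integral_density)
       (auto intro!: nn_integral_cong simp: exponential_density_def ennreal_mult'[symmetric] exp_minus field_simps)
  also have "\<dots> = ennreal (Gamma (1 / 2))"
    by (rule Gamma_conv_nn_integral_real[symmetric]) simp
  finally have "integrable exponential_measure (\<lambda>x. x powr (- 1 / 2))"
    by (intro integrableI_nonneg) auto
  then show "integrable exponential_measure (\<lambda>x. x + 2 * x powr (- 1 / 2))"
    by (intro Bochner_Integration.integrable_add exponential_measure_id integrable_mult_right)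
  show "AE x in exponential_measure. norm \<bar>ln x\<bar> \<le> norm (x + 2 * x powr (- 1 / 2))"
    using AE_exponential_measure_pos
  proof eventually_elim
    case (elim x)
    then show ?case using abs_ln_le[OF elim] by simp
  qed
qed measurable

section \<open>The integrable envelope of the logarithms\<close>

text \<open>A sum of two one-sided bounds for p = (x, y): 1 + (1 + x) y controls the logarithm from
  above, and ln 2 + |ln x| + |ln y| controls its negative.\<close>

definition ln_envelope :: "real \<times> real \<Rightarrow> real" where
  "ln_envelope p = 1 + (1 + fst p) * snd p + ln 2 + \<bar>ln (fst p)\<bar> + \<bar>ln (snd p)\<bar>"

lemma integrable_ln_envelope:
  "integrable (exponential_measure \<Otimes>\<^sub>M exponential_measure) ln_envelope"
proof (rule ex2.Fubini_integrable)
  show "ln_envelope \<in> borel_measurable (exponential_measure \<Otimes>\<^sub>M exponential_measure)"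
    unfolding ln_envelope_def by measurable
  have int: "integrable exponential_measure (\<lambda>y. ln_envelope (x, y))" for x
    unfolding ln_envelope_def using exponential_measure_id integrable_exponential_measure_abs_ln by simp
  then show "AE x in exponential_measure. integrable exponential_measure (\<lambda>y. ln_envelope (x, y))" by simp
  let ?L = "\<integral>y. \<bar>ln y\<bar> \<partial>exponential_measure"
  have inner: "(\<integral>y. ln_envelope (x, y) \<partial>exponential_measure) = 1 + (1 + x) + ln 2 + \<bar>ln x\<bar> + ?L" for x
    unfolding ln_envelope_def using exponential_measure_id integrable_exponential_measure_abs_ln
    by (simp add: ex.prob_space[simplified])
  show "integrable exponential_measure (\<lambda>x. \<integral>y. norm (ln_envelope (x, y)) \<partial>exponential_measure)"
  proof (subst integrable_cong_AE)
    show "AE x in exponential_measure. (\<integral>y. norm (ln_envelope (x, y)) \<partial>exponential_measure)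
        = 1 + (1 + x) + ln 2 + \<bar>ln x\<bar> + ?L"
      using AE_exponential_measure_pos
    proof eventually_elim
      case (elim x)
      have "(\<integral>y. norm (ln_envelope (x, y)) \<partial>exponential_measure) = (\<integral>y. ln_envelope (x, y) \<partial>exponential_measure)"
        using AE_exponential_measure_pos elim
        by (intro integral_cong_AE) (auto simp: ln_envelope_def elim!: eventually_mono)
      then show ?case by (simp add: inner)
    qed
    show "integrable exponential_measure (\<lambda>x. 1 + (1 + x) + ln 2 + \<bar>ln x\<bar> + ?L)"
      using exponential_measure_id integrable_exponential_measure_abs_ln by simp
  qed (simp_all add: ln_envelope_def)
qed

text \<open>The upper bound is ln k \<le> k - 1 with \<open>d \<le> 1\<close>. For the lower bound
  either \<open>b\<close> is at least 1/2, and so is \<open>k\<close>, or 1 - a - b + a x is at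
  least (1 - b) min 1 x and thus at least half of min 1 x. No constant depends on \<open>a\<close>
  or \<open>b\<close>. Since \<open>k\<close> is only confined between two bounds, both the phase
  mean and its limit are covered.\<close>

lemma ln_envelope_bound:
  assumes "0 \<le> a" "0 \<le> b" "a + b \<le> 1" "0 < x" "0 < y"
    and k: "max b ((1 - a - b + a * x) * y) \<le> k" "k \<le> d + b + (1 - a - b + a * x) * y" "0 \<le> d" "d \<le> 1"
    and pos: "0 < k"
  shows "\<bar>ln k\<bar> \<le> ln_envelope (x, y)"
proof -
  define t where "t = 1 - a - b + a * x"
  have ax: "a * x \<le> x" using mult_right_mono[of a 1 x] assms by simp
  have ty: "t * y \<le> (1 - b + x) * y" unfolding t_def using assms ax by (intro mult_right_mono) linarith+
  have "ln k \<le> k - 1" by (rule ln_le_minus_one[OF pos])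
  also have "\<dots> \<le> b + t * y" using k unfolding t_def by simp
  also have "\<dots> \<le> 1 + (1 + x) * y"
  proof -
    have "0 \<le> b * y" "b \<le> 1" using assms by auto
    then show ?thesis using ty by (simp add: algebra_simps)
  qed
  finally have up: "ln k \<le> 1 + (1 + x) * y" .
  have "- (ln 2 + \<bar>ln x\<bar> + \<bar>ln y\<bar>) \<le> ln k"
  proof (cases "1 / 2 \<le> b")
    case True
    then have "ln (1 / 2) \<le> ln k" using k pos by (intro ln_mono) auto
    then show ?thesis by (simp add: ln_div)
  next
    case False
    have m: "0 < min 1 x" "min 1 x \<le> 1" "min 1 x \<le> x" using assms by auto
    have "(1 / 2) * min 1 x \<le> (1 - b) * min 1 x" using False m by (intro mult_right_mono) auto
    also have "\<dots> = (1 - a - b) * min 1 x + a * min 1 x" by (simp add: algebra_simps)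
    also have "\<dots> \<le> (1 - a - b) * 1 + a * x" using m assms by (intro add_mono mult_left_mono) auto
    finally have "(1 / 2) * min 1 x \<le> t" by (simp add: t_def)
    then have "(1 / 2) * min 1 x * y \<le> t * y" using assms by (intro mult_right_mono) auto
    also have "\<dots> \<le> k" using k by (simp add: t_def)
    finally have "ln ((1 / 2) * min 1 x * y) \<le> ln k" using m assms pos by (intro ln_mono) auto
    moreover have "ln ((1 / 2) * min 1 x * y) = ln (1 / 2) + ln (min 1 x) + ln y"
      using m(1) assms(5) by (subst ln_mult_pos, simp, simp)+ simp
    moreover have "ln (1 / 2 :: real) = - ln 2" by (simp add: ln_div)
    moreover have "- \<bar>ln x\<bar> \<le> ln (min 1 x)" by (auto simp: min_def)
    moreover have "- \<bar>ln y\<bar> \<le> ln y" by simp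
    ultimately show ?thesis by linarith
  qed
  moreover have "0 \<le> (1 + x) * y" using assms by simp
  moreover have "0 \<le> ln (2 :: real)" by simp
  ultimately show ?thesis using up unfolding ln_envelope_def fst_conv snd_conv abs_le_iff by linarith
qed

section \<open>The limit integrand and the two passages to the limit\<close>

definition limit_integrand :: "real \<Rightarrow> real \<Rightarrow> real \<times> real \<Rightarrow> real" where
  "limit_integrand a b p = ln (max b ((1 - a - b + a * fst p) * snd p))"

lemma measurable_limit_integrand [measurable]:
  "limit_integrand a b \<in> borel_measurable (exponential_measure \<Otimes>\<^sub>M exponential_measure)"
  unfolding limit_integrand_def by measurable

lemma max_fading_pos:
  assumes "0 \<le> a" "0 \<le> b" "a + b \<le> 1" "0 < x" "0 < y"
  shows "0 < max b ((1 - a - b + a * x) * (y::real))"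
proof (cases "b = 0")
  case True
  have "0 < 1 - a + a * x" using assms True
    by (cases "a = 0") (auto intro!: add_nonneg_pos)
  then show ?thesis using assms True by simp
qed (use assms in \<open>auto simp: less_max_iff_disj\<close>)

lemma limit_integrand_bound:
  assumes "0 \<le> a" "0 \<le> b" "a + b \<le> 1" "0 < fst p" "0 < snd p"
  shows "\<bar>limit_integrand a b p\<bar> \<le> ln_envelope p"
proof -
  have "0 \<le> (1 - a - b + a * fst p) * snd p" using assms by auto
  then show ?thesis
    using ln_envelope_bound[OF assms order_refl _ _ _ max_fading_pos[OF assms], of 0] assms
    by (simp add: limit_integrand_def)
qed

lemma integrable_limit_integrand:
  assumes "0 \<le> a" "0 \<le> b" "a + b \<le> 1"
  shows "integrable (exponential_measure \<Otimes>\<^sub>M exponential_measure) (limit_integrand a b)"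
proof (rule Bochner_Integration.integrable_bound[OF integrable_ln_envelope])
  show "AE p in exponential_measure \<Otimes>\<^sub>M exponential_measure. norm (limit_integrand a b p) \<le> norm (ln_envelope p)"
    using AE_exponential_measure2_pos
  proof eventually_elim
    case (elim p)
    then show ?case using limit_integrand_bound[OF assms, of p] by simp
  qed
qed measurable

definition log_mean :: "real \<Rightarrow> real \<Rightarrow> real" where
  "log_mean a b = (\<integral>p. limit_integrand a b p \<partial>(exponential_measure \<Otimes>\<^sub>M exponential_measure))"

text \<open>Dominated convergence, with the right-hand limit at 0 rewritten as a limit at infinity
  in the inverse. The envelope is uniform in the weights, so the first weight may move along with
  \<open>b\<close>, which covers \<open>a = 1\<close>.\<close>

lemma tendsto_log_mean:
  assumes a: "0 \<le> a" "a \<le> 1"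
  shows "((\<lambda>b. log_mean (min a (1 - b)) b) \<longlongrightarrow> log_mean a 0) (at_right 0)"
  unfolding filterlim_at_right_to_top log_mean_def
proof (rule integral_dominated_convergence_at_top[where w=ln_envelope])
  show "\<forall>\<^sub>F b in at_top. AE p in exponential_measure \<Otimes>\<^sub>M exponential_measure.
      norm (limit_integrand (min a (1 - inverse b)) (inverse b) p) \<le> ln_envelope p"
    using eventually_ge_at_top[of "1::real"]
  proof eventually_elim
    case (elim b)
    then have b: "0 \<le> inverse b" "inverse b \<le> 1" by (simp_all add: inverse_le_1_iff)
    show ?case using AE_exponential_measure2_pos
    proof eventually_elim
      case (elim p)
      then show ?case using b a by (auto intro!: limit_integrand_bound)
    qed
  qed
  show "AE p in exponential_measure \<Otimes>\<^sub>M exponential_measure.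
      ((\<lambda>b. limit_integrand (min a (1 - inverse b)) (inverse b) p) \<longlongrightarrow> limit_integrand a 0 p) at_top"
    using AE_exponential_measure2_pos
  proof eventually_elim
    case (elim p)
    have i: "(inverse \<longlongrightarrow> (0::real)) at_top" by (rule tendsto_inverse_0_at_top[OF filterlim_ident])
    have "((\<lambda>b. min a (1 - inverse b)) \<longlongrightarrow> min a (1 - 0)) at_top"
      by (intro tendsto_intros i)
    then have m: "((\<lambda>b. min a (1 - inverse b)) \<longlongrightarrow> a) at_top" using a by simp
    have "0 < max 0 ((1 - a - 0 + a * fst p) * snd p)"
      using a elim by (intro max_fading_pos) auto
    then show ?case unfolding limit_integrand_def
      by (intro tendsto_ln tendsto_max tendsto_mult tendsto_add tendsto_diff tendsto_const i m) linarith
  qed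
qed (simp_all add: integrable_ln_envelope)

text \<open>Dominated convergence again: for \<open>g \<ge> 1\<close> the shift
  \<open>d = 1 / g\<close> is at most 1, as the envelope demands. Pointwise the limit is the phase
  mean at \<open>d = 0\<close>, where the discriminant is the square of b - r and the root is max b
  r.\<close>

lemma tendsto_phase_mean_integral:
  assumes "0 \<le> a" "0 \<le> b" "a + b \<le> 1"
  shows "((\<lambda>g. \<integral>p. ln (phase_mean (1 / g) b ((1 - a - b + a * fst p) * snd p))
      \<partial>(exponential_measure \<Otimes>\<^sub>M exponential_measure)) \<longlongrightarrow> log_mean a b) at_top"
    and "\<And>g. 1 \<le> g \<Longrightarrow> integrable (exponential_measure \<Otimes>\<^sub>M exponential_measure)
      (\<lambda>p. ln (phase_mean (1 / g) b ((1 - a - b + a * fst p) * snd p)))"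
proof -
  let ?k = "\<lambda>g p. phase_mean (1 / g) b ((1 - a - b + a * fst p) * snd p)"
  have m [measurable]: "(\<lambda>p. ln (?k g p)) \<in> borel_measurable (exponential_measure \<Otimes>\<^sub>M exponential_measure)" for g
    unfolding phase_mean_def by measurable
  have bound: "AE p in exponential_measure \<Otimes>\<^sub>M exponential_measure. norm (ln (?k g p)) \<le> ln_envelope p"
    if g: "1 \<le> g" for g
    using AE_exponential_measure2_pos
  proof eventually_elim
    case (elim p)
    then have "0 \<le> (1 - a - b + a * fst p) * snd p" using assms by auto
    note P = phase_mean_props[of "1 / g", OF _ assms(2) this]
    have "\<bar>ln (?k g p)\<bar> \<le> ln_envelope (fst p, snd p)"
      using elim g P by (intro ln_envelope_bound[OF assms, where d="1 / g"]) auto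
    then show ?case by simp
  qed
  show "integrable (exponential_measure \<Otimes>\<^sub>M exponential_measure) (\<lambda>p. ln (?k g p))" if "1 \<le> g" for g
    by (rule Bochner_Integration.integrable_bound[OF integrable_ln_envelope m])
       (use bound[OF that] in eventually_elim, simp)
  show "((\<lambda>g. \<integral>p. ln (?k g p) \<partial>(exponential_measure \<Otimes>\<^sub>M exponential_measure)) \<longlongrightarrow> log_mean a b) at_top"
    unfolding log_mean_def
  proof (rule integral_dominated_convergence_at_top[where w=ln_envelope])
    show "\<forall>\<^sub>F g in at_top. AE p in exponential_measure \<Otimes>\<^sub>M exponential_measure. norm (ln (?k g p)) \<le> ln_envelope p"
      using eventually_ge_at_top[of "1::real"] by eventually_elim (rule bound)
    show "AE p in exponential_measure \<Otimes>\<^sub>M exponential_measure.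
        ((\<lambda>g. ln (?k g p)) \<longlongrightarrow> limit_integrand a b p) at_top"
      using AE_exponential_measure2_pos
    proof eventually_elim
      case (elim p)
      define r where "r = (1 - a - b + a * fst p) * snd p"
      have pos: "0 < max b r" using max_fading_pos[OF assms] elim by (simp add: r_def)
      have i: "((\<lambda>g. 1 / g) \<longlongrightarrow> (0::real)) at_top" by real_asymp
      have "sqrt ((0 + b + r)\<^sup>2 - 4 * b * r) = \<bar>b - r\<bar>"
        unfolding real_sqrt_abs[symmetric] by (simp add: power2_eq_square algebra_simps)
      then have "phase_mean 0 b r = max b r" unfolding phase_mean_def by (simp add: max_def)
      moreover have "((\<lambda>g. phase_mean (1 / g) b r) \<longlongrightarrow> phase_mean 0 b r) at_top"
        unfolding phase_mean_def by (intro tendsto_intros i) simp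
      ultimately have "((\<lambda>g. ln (phase_mean (1 / g) b r)) \<longlongrightarrow> ln (max b r)) at_top"
        using pos by (intro tendsto_ln) auto
      then show ?case by (simp add: r_def limit_integrand_def)
    qed
  qed (simp_all add: m integrable_ln_envelope)
qed

section \<open>The exponential integral and the closed form of the loss\<close>

lemma integral_exponential_measure:
  fixes f :: "real \<Rightarrow> real"
  assumes [measurable]: "f \<in> borel_measurable borel"
  shows "(\<integral>x. f x \<partial>exponential_measure) = (\<integral>x. exponential_density 1 x * f x \<partial>lborel)"
  unfolding exponential_measure_def
  by (subst integral_density) (simp_all add: exponential_density_nonneg)

lemma integrable_exponential_measure_iff:
  fixes f :: "real \<Rightarrow> real"
  assumes [measurable]: "f \<in> borel_measurable borel"
  shows "integrable exponential_measure f \<longleftrightarrow> integrable lborel (\<lambda>x. exponential_density 1 x * f x)"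
  unfolding exponential_measure_def
  by (subst integrable_density) (simp_all add: exponential_density_nonneg)

lemma integrable_ln_max_exponential:
  assumes u: "0 < u"
  shows "integrable exponential_measure (\<lambda>y. ln (max 1 (y / u)))"
proof (rule Bochner_Integration.integrable_bound)
  show "integrable exponential_measure (\<lambda>y. 1 + y / u)"
    using exponential_measure_id by simp
  show "AE y in exponential_measure. norm (ln (max 1 (y / u))) \<le> norm (1 + y / u)"
    using AE_exponential_measure_pos
  proof eventually_elim
    case (elim y)
    then have "0 < y / u" using u by simp
    then show ?case using ln_le_minus_one[of "max 1 (y / u)"] by (auto simp: max_def)
  qed
qed measurable

text \<open>Integration by parts on y > u, where alone the logarithm is nonzero. The function - exp
  (- y) ln (y / u) has derivative exp (- y) ln (y / u) - exp (- y) / y and vanishes at both ends, so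
  the two integrals agree.\<close>

lemma exp_integral_E1_eq:
  assumes u: "0 < u"
  shows "(\<integral>y. ln (max 1 (y / u)) \<partial>exponential_measure) = exp_integral_E1 (ereal u)"
proof -
  have e: "einterval (ereal u) \<infinity> = {u<..}" by (auto simp: einterval_def)
  have int1: "set_integrable lborel {u<..} (\<lambda>y. exp (- y) * ln (y / u))"
  proof -
    note integrable_ln_max_exponential[OF u]
    then have "integrable lborel (\<lambda>y. exponential_density 1 y * ln (max 1 (y / u)))"
      by (subst (asm) integrable_exponential_measure_iff) auto
    also have "(\<lambda>y. exponential_density 1 y * ln (max 1 (y / u)))
        = (\<lambda>y. indicator {u<..} y *\<^sub>R (exp (- y) * ln (y / u)))"
      using u by (auto simp: exponential_density_def fun_eq_iff max_def field_simps split: split_indicator)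
    finally show ?thesis by (simp add: set_integrable_def)
  qed
  have int2: "set_integrable lborel {u<..} (\<lambda>y. exp (- y) / y)"
    unfolding set_integrable_def
  proof (rule Bochner_Integration.integrable_bound)
    have "integrable exponential_measure (\<lambda>y. 1 / u)" by simp
    then show "integrable lborel (\<lambda>y. exponential_density 1 y * (1 / u))"
      by (subst (asm) integrable_exponential_measure_iff) auto
    show "AE y in lborel. norm (indicator {u<..} y *\<^sub>R (exp (- y) / y)) \<le> norm (exponential_density 1 y * (1 / u))"
      using u by (auto simp: exponential_density_def frac_le split: split_indicator)
  qed measurable
  have "(LBINT y=ereal u..\<infinity>. exp (- y) * ln (y / u) - exp (- y) / y) = 0 - 0"
  proof (rule interval_integral_FTC_integrable[where F="\<lambda>y. - (exp (- y) * ln (y / u))"])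
    fix x assume "ereal u < ereal x"
    then have x: "u < x" "0 < x" using u by auto
    show "((\<lambda>y. - (exp (- y) * ln (y / u))) has_vector_derivative exp (- x) * ln (x / u) - exp (- x) / x) (at x)"
      unfolding has_real_derivative_iff_has_vector_derivative[symmetric]
      using x u by (auto intro!: derivative_eq_intros simp: field_simps)
    show "isCont (\<lambda>y. exp (- y) * ln (y / u) - exp (- y) / y) x"
      using x u by (intro continuous_intros) auto
  next
    show "set_integrable lborel (einterval (ereal u) \<infinity>) (\<lambda>y. exp (- y) * ln (y / u) - exp (- y) / y)"
      unfolding e by (rule set_integral_diff[OF int1 int2])
    have "((\<lambda>y. - (exp (- y) * ln (y / u))) \<longlongrightarrow> - (exp (- u) * ln (u / u))) (at_right u)"
      using u by (intro tendsto_intros) auto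
    then show "(((\<lambda>y. - (exp (- y) * ln (y / u))) \<circ> real_of_ereal) \<longlongrightarrow> 0) (at_right (ereal u))"
      using u by (simp add: ereal_tendsto_simps)
    have "((\<lambda>y. - (exp (- y) * ln (y / u))) \<longlongrightarrow> 0) at_top"
      using u by real_asymp
    then show "(((\<lambda>y. - (exp (- y) * ln (y / u))) \<circ> real_of_ereal) \<longlongrightarrow> 0) (at_left \<infinity>)"
      by (simp add: ereal_tendsto_simps)
  qed simp
  then have "(LBINT y:{u<..}. exp (- y) * ln (y / u) - exp (- y) / y) = 0"
    by (simp add: interval_lebesgue_integral_def e)
  then have "(LBINT y:{u<..}. exp (- y) * ln (y / u)) = (LBINT y:{u<..}. exp (- y) / y)"
    by (simp add: set_integral_diff[OF int1 int2])
  also have "\<dots> = exp_integral_E1 (ereal u)"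
    by (simp add: exp_integral_E1_def interval_lebesgue_integral_def e)
  also have "(LBINT y:{u<..}. exp (- y) * ln (y / u)) = (\<integral>y. exponential_density 1 y * ln (max 1 (y / u)) \<partial>lborel)"
    unfolding set_lebesgue_integral_def using u
    by (intro Bochner_Integration.integral_cong)
       (auto simp: exponential_density_def max_def field_simps split: split_indicator)
  finally show ?thesis by (simp add: integral_exponential_measure)
qed

lemma integral_ln_max_exponential:
  assumes b: "0 < b" and s: "0 \<le> s"
  shows "(\<integral>y. ln (max b (s * y)) \<partial>exponential_measure) = ln b + exp_integral_E1 (ereal b / ereal s)"
proof (cases "s = 0")
  case True
  \<comment> \<open>The infinite quotient makes the interval of E1 empty, which matches the constant
    integrand \<open>ln b\<close>.\<close>
  moreover have "ereal b / ereal 0 = \<infinity>" using b by simp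
  ultimately show ?thesis
    using b ex.prob_space by (simp add: exp_integral_E1_def max_def del: ereal_divide)
next
  case False
  define u where "u = b / s"
  have u: "0 < u" using False assms by (simp add: u_def)
  have "ln (max b (s * y)) = ln b + ln (max 1 (y / u))" for y
  proof -
    have "max b (s * y) = b * max 1 (y / u)" using b by (simp add: u_def max_mult_distrib_left mult.commute)
    then show ?thesis using b by (simp add: ln_mult_pos less_max_iff_disj)
  qed
  moreover note integrable_ln_max_exponential[OF u]
  ultimately show ?thesis
    using exp_integral_E1_eq[OF u] False ex.prob_space by (simp add: u_def)
qed

text \<open>By Fubini the inner expectation equals ln b plus an E1 term. Integrating out
  \<open>x\<close> isolates the E1 integral as \<open>log_mean a b - ln b\<close>, and its
  \<open>ln b\<close> cancels the leading logarithm of the loss.\<close>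

lemma capacity_loss_expr_eq:
  assumes a: "0 \<le> a" and b: "0 < b" and ab: "a + b \<le> 1"
  shows "capacity_loss_expr a b = - log_mean a b / ln 2"
proof -
  let ?E = "\<lambda>x. exp_integral_E1 (ereal b / ereal (1 - b - a * (1 - x)))"
  have int: "integrable (exponential_measure \<Otimes>\<^sub>M exponential_measure) (limit_integrand a b)"
    using integrable_limit_integrand assms by simp
  let ?I = "\<lambda>x. \<integral>y. limit_integrand a b (x, y) \<partial>exponential_measure"
  have intI: "integrable exponential_measure ?I"
    by (rule ex2.integrable_fst'[OF int])
  have [measurable]: "?I \<in> borel_measurable borel"
    using borel_measurable_integrable[OF intI] by simp
  have I: "?I x = ln b + ?E x" if "0 \<le> x" for x
  proof -
    have s: "1 - b - a * (1 - x) = 1 - a - b + a * x" by (simp add: algebra_simps)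
    have "0 \<le> 1 - a - b + a * x" using that a ab by simp
    then show ?thesis unfolding s
      using integral_ln_max_exponential[OF b] by (simp add: limit_integrand_def)
  qed
  have e: "einterval 0 \<infinity> = {0<..}" by (auto simp: einterval_def)
  have "(LBINT x=0..\<infinity>. ?E x * exp (- x)) = (\<integral>x. indicator {0<..} x * (?E x * exp (- x)) \<partial>lborel)"
    by (simp add: interval_lebesgue_integral_def set_lebesgue_integral_def e)
  \<comment> \<open>The formula for the inner expectation holds for \<open>0 \<le> x\<close>, so the
    replacement is made while the indicator is present.\<close>
  also have "\<dots> = (\<integral>x. indicator {0<..} x * (exponential_density 1 x * (?I x - ln b)) \<partial>lborel)"
    using I by (intro Bochner_Integration.integral_cong)
      (auto simp: exponential_density_def split: split_indicator)
  also have "\<dots> = (\<integral>x. exponential_density 1 x * (?I x - ln b) \<partial>lborel)"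
    using AE_lborel_singleton[of "0::real"]
    by (intro integral_cong_AE) (auto simp: exponential_density_def split: split_indicator)
  also have "\<dots> = (\<integral>x. ?I x - ln b \<partial>exponential_measure)"
    by (rule integral_exponential_measure[symmetric]) measurable
  also have "\<dots> = log_mean a b - ln b"
    using intI ex.prob_space ex2.integral_fst'[OF int] by (simp add: log_mean_def)
  finally have I: "(LBINT x=0..\<infinity>. ?E x * exp (- x)) = log_mean a b - ln b" .
  show ?thesis unfolding capacity_loss_expr_def I by (simp add: log_def field_simps)
qed

text \<open>The expectation \<open>log_mean\<close> has a value at \<open>b = 0\<close> as well, and
  its continuity there shows that the limit defining the loss exists.\<close>

lemma capacity_loss_eq:
  assumes "0 \<le> a" "0 \<le> b" "a + b \<le> 1"
  shows "capacity_loss a b = - log_mean a b / ln 2"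
    and "b = 0 \<Longrightarrow> ((\<lambda>b. capacity_loss_expr (min a (1 - b)) b) \<longlongrightarrow> capacity_loss a b) (at_right 0)"
proof -
  have lim: "((\<lambda>b. capacity_loss_expr (min a (1 - b)) b) \<longlongrightarrow> - log_mean a 0 / ln 2) (at_right 0)"
    if "b = 0"
  proof (rule Lim_transform_eventually)
    show "((\<lambda>b. - log_mean (min a (1 - b)) b / ln 2) \<longlongrightarrow> - log_mean a 0 / ln 2) (at_right 0)"
      using assms that by (intro tendsto_intros tendsto_log_mean) auto
    \<comment> \<open>For 0 < b < 1 the weights \<open>min a (1 - b)\<close> and \<open>b\<close>
      are admissible, so the closed form applies.\<close>
    have "\<forall>\<^sub>F b in at_right 0. b \<in> {0<..<1::real}" by (rule eventually_at_right_real) simp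
    then show "\<forall>\<^sub>F b in at_right 0. - log_mean (min a (1 - b)) b / ln 2 = capacity_loss_expr (min a (1 - b)) b"
      by eventually_elim (use assms in \<open>auto simp: capacity_loss_expr_eq\<close>)
  qed
  show eq: "capacity_loss a b = - log_mean a b / ln 2"
  proof (cases "b = 0")
    case True
    then show ?thesis using tendsto_Lim[OF _ lim[OF True]] by (simp add: capacity_loss_def)
  next
    case False
    then show ?thesis using capacity_loss_expr_eq assms by (simp add: capacity_loss_def)
  qed
  show "((\<lambda>b. capacity_loss_expr (min a (1 - b)) b) \<longlongrightarrow> capacity_loss a b) (at_right 0)" if "b = 0"
    using lim[OF that] eq that by simp
qed

section \<open>The channel\<close>

text \<open>Independence makes the joint law a product measure on the index set, and its coordinates
  are split off one at a time, with index 0 ending up innermost.\<close>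

lemma (in prob_space) nn_integral_indep_vars4:
  fixes X :: "nat \<Rightarrow> 'a \<Rightarrow> complex"
  assumes ind: "indep_vars (\<lambda>_. borel) X {..<4}"
    and [measurable]: "(\<lambda>(a, b, c, d). h a b c d) \<in> borel_measurable (borel \<Otimes>\<^sub>M borel \<Otimes>\<^sub>M borel \<Otimes>\<^sub>M borel)"
  shows "(\<integral>\<^sup>+w. h (X 0 w) (X 1 w) (X 2 w) (X 3 w) \<partial>M)
    = (\<integral>\<^sup>+d. \<integral>\<^sup>+c. \<integral>\<^sup>+b. \<integral>\<^sup>+a. h a b c d \<partial>distr M borel (X 0) \<partial>distr M borel (X 1)
        \<partial>distr M borel (X 2) \<partial>distr M borel (X 3))"
proof -
  \<comment> \<open>The family is padded with constants so that there is a probability law at every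
    natural index, as \<open>product_prob_space\<close> requires.\<close>
  define Y where "Y i = (if i < 4 then X i else (\<lambda>_. 0))" for i
  have rv[measurable]: "Y i \<in> borel_measurable M" for i
    using ind by (auto simp: Y_def indep_vars_def)
  have "indep_vars (\<lambda>_. borel) Y {..<4}"
    using ind by (rule indep_vars_cong[THEN iffD1, rotated -1]) (auto simp: Y_def)
  then have eq: "distr M (\<Pi>\<^sub>M i\<in>{..<4}. borel) (\<lambda>x. \<lambda>i\<in>{..<4}. Y i x) = (\<Pi>\<^sub>M i\<in>{..<4}. distr M borel (Y i))"
    by (subst (asm) indep_vars_iff_distr_eq_PiM) (auto simp: lessThan_empty_iff bot_nat_def)
  define D where "D i = distr M borel (Y i)" for i
  have D_sets [simp, measurable_cong]: "sets (D i) = sets borel" for i by (simp add: D_def)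
  interpret product_prob_space D
    by (intro product_prob_spaceI) (simp add: D_def prob_space_distr)
  have [measurable_cong]: "sets (PiM I D) = sets (PiM I (\<lambda>_. borel))" for I
    by (intro sets_PiM_cong) auto
  define H where "H v = h (v 0) (v 1) (v 2) (v 3)" for v :: "nat \<Rightarrow> complex"
  have four: "{..<4} = {0, 1, 2, 3::nat}" by auto
  have [measurable]: "(\<lambda>v. h (p v) (q v) (r v) (s v)) \<in> borel_measurable N"
    if [measurable]: "p \<in> borel_measurable N" "q \<in> borel_measurable N" "r \<in> borel_measurable N"
      "s \<in> borel_measurable N" for N :: "'b measure" and p q r s
    using measurable_compose[of "\<lambda>v. (p v, q v, r v, s v)", OF _ assms(2)] by simp
  have [measurable]: "H \<in> borel_measurable (PiM {0, 1, 2, 3} (\<lambda>_. borel))"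
    unfolding H_def by measurable
  have "(\<integral>\<^sup>+w. h (X 0 w) (X 1 w) (X 2 w) (X 3 w) \<partial>M) = (\<integral>\<^sup>+w. H (\<lambda>i\<in>{..<4}. Y i w) \<partial>M)"
    by (simp add: H_def Y_def)
  also have "\<dots> = (\<integral>\<^sup>+v. H v \<partial>PiM {..<4} D)"
    unfolding D_def eq[symmetric] by (subst nn_integral_distr) (simp_all add: four del: One_nat_def)
  also have "\<dots> = (\<integral>\<^sup>+v. \<integral>\<^sup>+a. H (v(0 := a)) \<partial>D 0 \<partial>PiM {1, 2, 3} D)"
    unfolding four by (subst product_nn_integral_insert) (simp_all del: One_nat_def)
  also have "\<dots> = (\<integral>\<^sup>+v. \<integral>\<^sup>+b. \<integral>\<^sup>+a. H (v(1 := b, 0 := a)) \<partial>D 0 \<partial>D 1 \<partial>PiM {2, 3} D)"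
    by (subst product_nn_integral_insert) (simp_all add: H_def del: One_nat_def)
  also have "\<dots> = (\<integral>\<^sup>+v. \<integral>\<^sup>+c. \<integral>\<^sup>+b. \<integral>\<^sup>+a. H (v(2 := c, 1 := b, 0 := a)) \<partial>D 0 \<partial>D 1 \<partial>D 2 \<partial>PiM {3} D)"
    by (subst product_nn_integral_insert) (simp_all add: H_def del: One_nat_def)
  also have "\<dots> = (\<integral>\<^sup>+d. \<integral>\<^sup>+c. \<integral>\<^sup>+b. \<integral>\<^sup>+a. h a b c d \<partial>D 0 \<partial>D 1 \<partial>D 2 \<partial>D 3)"
    by (subst product_nn_integral_singleton[symmetric]) (simp_all add: H_def del: One_nat_def)
  finally show ?thesis by (simp add: D_def Y_def)
qed

text \<open>Independent parts have a product joint law, and \<open>complex_gauss\<close> is its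
  image under \<open>Complex\<close>.\<close>

lemma (in prob_space) distr_circular_complex_gaussian:
  assumes "circular_complex_gaussian M G 1"
  shows "distr M borel G = complex_gauss"
proof -
  let ?R = "\<lambda>w. Re (G w)" and ?I = "\<lambda>w. Im (G w)"
  have ind: "indep_var borel ?R borel ?I"
    and d: "distributed M lborel ?R (normal_density 0 (sqrt (1 / 2)))"
           "distributed M lborel ?I (normal_density 0 (sqrt (1 / 2)))"
    using assms by (auto simp: circular_complex_gaussian_def)
  have [measurable]: "?R \<in> borel_measurable M" "?I \<in> borel_measurable M"
    using d by (auto dest: distributed_measurable)
  have l: "distr M borel ?R = half_normal" "distr M borel ?I = half_normal"
    using d[THEN distributed_distr_eq_density]
    by (simp_all add: half_normal_def cong: distr_cong)
  have "half_normal \<Otimes>\<^sub>M half_normal = distr M (borel \<Otimes>\<^sub>M borel) (\<lambda>w. (?R w, ?I w))"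
    using ind unfolding indep_var_distribution_eq l by simp
  then have "complex_gauss = distr M borel (\<lambda>w. Complex (?R w) (?I w))"
    unfolding complex_gauss_def by (simp add: distr_distr comp_def)
  then show ?thesis by simp
qed

context sosf_channel
begin

abbreviation "gain \<equiv> sosf_gain \<phi> G\<^sub>1 G\<^sub>2 G\<^sub>3 \<omega>\<^sub>0 \<omega>\<^sub>1 \<omega>\<^sub>2"

lemma measurable_exp_i: "(\<lambda>a::complex. exp (\<i> * a)) \<in> borel_measurable borel"
  by (intro borel_measurable_continuous_onI continuous_intros)

lemma measurable_phase [measurable]: "\<phi> \<in> borel_measurable M"
  using phase_uniform by (auto dest: distributed_measurable)

lemma measurable_components [measurable]:
  "G\<^sub>1 \<in> borel_measurable M" "G\<^sub>2 \<in> borel_measurable M" "G\<^sub>3 \<in> borel_measurable M"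
proof -
  have "(\<lambda>w. [complex_of_real (\<phi> w), G\<^sub>1 w, G\<^sub>2 w, G\<^sub>3 w] ! i) \<in> borel_measurable M" if "i < 4" for i
    using independent that by (auto simp: indep_vars_def)
  from this[of 1] this[of 2] this[of 3]
  show "G\<^sub>1 \<in> borel_measurable M" "G\<^sub>2 \<in> borel_measurable M" "G\<^sub>3 \<in> borel_measurable M" by simp_all
qed

lemma measurable_gain [measurable]: "gain \<in> borel_measurable M"
proof -
  have "(\<lambda>w. exp (\<i> * complex_of_real (\<phi> w))) \<in> borel_measurable M"
    by (rule measurable_compose[OF _ measurable_exp_i]) measurable
  then show ?thesis unfolding sosf_gain_def[abs_def] by measurable
qed

text \<open>The order of integration drives the reduction. The phase is averaged first; then, for a
  fixed value d of \<open>G\<^sub>3\<close>, the terms with \<open>G\<^sub>1\<close> and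
  \<open>G\<^sub>2\<close> merge into one Gaussian of power \<open>\<omega>\<^sub>1\<^sup>2 +
  \<omega>\<^sub>2\<^sup>2 * (cmod d)\<^sup>2\<close>; finally both squared moduli are
  exponential.\<close>

lemma nn_integral_gain:
  assumes g: "0 < g"
  shows "(\<integral>\<^sup>+w. ennreal (ln (1 + g * (cmod (gain w))\<^sup>2)) \<partial>M)
    = (\<integral>\<^sup>+x. \<integral>\<^sup>+y. ennreal (ln g + ln (phase_mean (1 / g) (\<omega>\<^sub>0\<^sup>2) ((\<omega>\<^sub>1\<^sup>2 + \<omega>\<^sub>2\<^sup>2 * x) * y)))
        \<partial>exponential_measure \<partial>exponential_measure)"
proof -
  define h where "h a b c d = ennreal (ln (1 + g * (cmod (of_real \<omega>\<^sub>0 * exp (\<i> * a)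
      + of_real \<omega>\<^sub>1 * b + of_real \<omega>\<^sub>2 * c * d))\<^sup>2))" for a b c d
  define K where "K r = ennreal (ln g + ln (phase_mean (1 / g) (\<omega>\<^sub>0\<^sup>2) r))" for r
  have Km [measurable]: "K \<in> borel_measurable borel"
    unfolding K_def phase_mean_def by measurable
  note [measurable] = measurable_compose[OF _ measurable_exp_i]
  have hm [measurable]: "(\<lambda>(a, b, c, d). h a b c d) \<in> borel_measurable (borel \<Otimes>\<^sub>M borel \<Otimes>\<^sub>M borel \<Otimes>\<^sub>M borel)"
    unfolding h_def by measurable
  let ?X = "\<lambda>i w. [complex_of_real (\<phi> w), G\<^sub>1 w, G\<^sub>2 w, G\<^sub>3 w] ! i"
  have phase: "(\<integral>\<^sup>+a. h a b c d \<partial>distr M borel (\<lambda>w. complex_of_real (\<phi> w)))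
      = K ((cmod (of_real \<omega>\<^sub>1 * b + of_real \<omega>\<^sub>2 * d * c))\<^sup>2)" for b c d
  proof -
    \<comment> \<open>The law of the phase embedded in the complex plane is pulled back to the real
      phase, whose density is known.\<close>
    have "(\<integral>\<^sup>+a. h a b c d \<partial>distr M borel (\<lambda>w. complex_of_real (\<phi> w)))
        = (\<integral>\<^sup>+t. ennreal (indicator {0..<2 * pi} t / measure lborel {0..<2 * pi})
             * h (complex_of_real t) b c d \<partial>lborel)"
    proof -
      have 1: "(\<lambda>a. h a b c d) \<in> borel_measurable borel" unfolding h_def by measurable
      then have "(\<lambda>t. h (complex_of_real t) b c d) \<in> borel_measurable lborel"
        by (rule measurable_compose[rotated]) measurable
      from distributed_nn_integral[OF phase_uniform this] 1 show ?thesis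
        by (simp add: nn_integral_distr)
    qed
    also have "\<dots> = (\<integral>\<^sup>+t. ennreal (indicator {0..<2 * pi} t / (2 * pi)) *
        ennreal (ln (1 + g * (cmod (of_real \<omega>\<^sub>0 * cis t + (of_real \<omega>\<^sub>1 * b + of_real \<omega>\<^sub>2 * d * c)))\<^sup>2)) \<partial>lborel)"
      by (simp add: h_def cis_conv_exp ac_simps)
    also have "\<dots> = K ((cmod (of_real \<omega>\<^sub>1 * b + of_real \<omega>\<^sub>2 * d * c))\<^sup>2)"
      unfolding K_def by (rule nn_integral_phase[OF g weights_nonneg(1)])
    finally show ?thesis .
  qed
  have "(\<integral>\<^sup>+w. ennreal (ln (1 + g * (cmod (gain w))\<^sup>2)) \<partial>M)
      = (\<integral>\<^sup>+w. h (?X 0 w) (?X 1 w) (?X 2 w) (?X 3 w) \<partial>M)"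
    by (simp add: h_def sosf_gain_def)
  also have "\<dots> = (\<integral>\<^sup>+d. \<integral>\<^sup>+c. \<integral>\<^sup>+b. K ((cmod (of_real \<omega>\<^sub>1 * b + of_real \<omega>\<^sub>2 * d * c))\<^sup>2)
      \<partial>complex_gauss \<partial>complex_gauss \<partial>complex_gauss)"
    by (subst nn_integral_indep_vars4[OF independent hm])
       (simp add: phase gaussian[THEN distr_circular_complex_gaussian])
  also have "\<dots> = (\<integral>\<^sup>+d. \<integral>\<^sup>+z. K ((\<omega>\<^sub>1\<^sup>2 + \<omega>\<^sub>2\<^sup>2 * (cmod d)\<^sup>2) * (cmod z)\<^sup>2) \<partial>complex_gauss \<partial>complex_gauss)"
    by (subst nn_integral_complex_gauss_combination[where f="\<lambda>z. K ((cmod z)\<^sup>2)"])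
       (simp_all add: norm_mult power_mult_distrib)
  also have "\<dots> = (\<integral>\<^sup>+d. \<integral>\<^sup>+y. K ((\<omega>\<^sub>1\<^sup>2 + \<omega>\<^sub>2\<^sup>2 * (cmod d)\<^sup>2) * y) \<partial>exponential_measure \<partial>complex_gauss)"
    by (subst nn_integral_complex_gauss_cmod_square) simp_all
  also have "\<dots> = (\<integral>\<^sup>+x. \<integral>\<^sup>+y. K ((\<omega>\<^sub>1\<^sup>2 + \<omega>\<^sub>2\<^sup>2 * x) * y) \<partial>exponential_measure \<partial>exponential_measure)"
    by (rule nn_integral_complex_gauss_cmod_square
        [where h="\<lambda>x. \<integral>\<^sup>+y. K ((\<omega>\<^sub>1\<^sup>2 + \<omega>\<^sub>2\<^sup>2 * x) * y) \<partial>exponential_measure"]) measurable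
  finally show ?thesis unfolding K_def .
qed

end

section \<open>The capacity as an expectation and its high-SNR limit\<close>

text \<open>Both branches of the definition integrate log2 (1 + y) against the law of \<gamma>,
  which is carried by the nonnegative half-line; in the first branch the derivative serves as its
  density.\<close>

lemma (in prob_space) average_capacity_eq:
  assumes [measurable]: "\<gamma> \<in> borel_measurable M" and nonneg: "\<And>w. 0 \<le> \<gamma> w"
  shows "average_capacity M \<gamma> = (\<integral>w. log 2 (1 + \<gamma> w) \<partial>M)"
proof -
  define \<mu> where "\<mu> = distr M borel \<gamma>"
  have s [simp, measurable_cong]: "sets \<mu> = sets borel" by (simp add: \<mu>_def)
  interpret \<mu>: prob_space \<mu> unfolding \<mu>_def by (rule prob_space_distr) simp
  have law: "(\<integral>w. log 2 (1 + \<gamma> w) \<partial>M) = (\<integral>y. log 2 (1 + y) \<partial>\<mu>)"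
    unfolding \<mu>_def by (subst integral_distr) auto
  have ge: "AE y in \<mu>. 0 \<le> y"
    unfolding \<mu>_def using nonneg by (subst AE_distr_iff) auto
  show ?thesis
  proof (cases "absolutely_continuous lborel \<mu>")
    case True
    have e: "einterval 0 \<infinity> = {0<..}" by (auto simp: einterval_def)
    \<comment> \<open>The interval integral omits the endpoint 0, which is a null set of an
      absolutely continuous law.\<close>
    have "AE y in \<mu>. y \<noteq> 0"
      by (rule absolutely_continuous_AE[OF _ True AE_lborel_singleton]) simp
    with ge have gt: "AE y in \<mu>. 0 < y" by eventually_elim auto
    have "(LBINT y=0..\<infinity>. log 2 (1 + y) * enn2real (RN_deriv lborel \<mu> y))
        = (\<integral>y. enn2real (RN_deriv lborel \<mu> y) * (indicator {0<..} y * log 2 (1 + y)) \<partial>lborel)"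
      by (simp add: interval_lebesgue_integral_def set_lebesgue_integral_def e mult_ac)
    also have "\<dots> = (\<integral>y. indicator {0<..} y * log 2 (1 + y) \<partial>\<mu>)"
      by (rule sigma_finite_measure.RN_deriv_integral[OF sigma_finite_lborel, symmetric]) (auto simp: True \<mu>.sigma_finite_measure)
    also have "\<dots> = (\<integral>y. log 2 (1 + y) \<partial>\<mu>)"
      by (intro integral_cong_AE) (use gt in \<open>auto elim!: eventually_mono\<close>)
    finally show ?thesis
      using True by (simp add: average_capacity_def Let_def \<mu>_def[symmetric] law)
  next
    case False
    have "(LINT y:{0..}|\<mu>. log 2 (1 + y)) = (\<integral>y. log 2 (1 + y) \<partial>\<mu>)"
      unfolding set_lebesgue_integral_def
      by (intro integral_cong_AE) (use ge in \<open>auto elim!: eventually_mono\<close>)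
    then show ?thesis
      using False by (simp add: average_capacity_def Let_def \<mu>_def[symmetric] law)
  qed
qed

context sosf_channel
begin

lemma average_capacity_gain:
  assumes g: "1 \<le> g"
  shows "average_capacity M (instantaneous_snr gain g)
    = (ln g + (\<integral>p. ln (phase_mean (1 / g) (\<omega>\<^sub>0\<^sup>2) ((1 - \<omega>\<^sub>2\<^sup>2 - \<omega>\<^sub>0\<^sup>2 + \<omega>\<^sub>2\<^sup>2 * fst p) * snd p))
        \<partial>(exponential_measure \<Otimes>\<^sub>M exponential_measure))) / ln 2"
proof -
  define K where "K p = ln (phase_mean (1 / g) (\<omega>\<^sub>0\<^sup>2) ((1 - \<omega>\<^sub>2\<^sup>2 - \<omega>\<^sub>0\<^sup>2 + \<omega>\<^sub>2\<^sup>2 * fst p) * snd p))" for p :: "real \<times> real"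
  have Km [measurable]: "K \<in> borel_measurable (borel \<Otimes>\<^sub>M borel)"
    unfolding K_def phase_mean_def by measurable
  have w: "0 \<le> \<omega>\<^sub>2\<^sup>2" "0 \<le> \<omega>\<^sub>0\<^sup>2" "\<omega>\<^sub>2\<^sup>2 + \<omega>\<^sub>0\<^sup>2 \<le> 1" "\<omega>\<^sub>1\<^sup>2 = 1 - \<omega>\<^sub>2\<^sup>2 - \<omega>\<^sub>0\<^sup>2"
    using normalized zero_le_power2[of \<omega>\<^sub>1] by (simp_all, linarith+)
  \<comment> \<open>The phase mean is at least its shift 1 / g, so this sum is nonnegative and its
    \<open>ennreal\<close> integral turns back into a Bochner integral.\<close>
  have nonneg: "AE p in exponential_measure \<Otimes>\<^sub>M exponential_measure. 0 \<le> ln g + K p"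
    using AE_exponential_measure2_pos
  proof eventually_elim
    case (elim p)
    then have "0 \<le> (1 - \<omega>\<^sub>2\<^sup>2 - \<omega>\<^sub>0\<^sup>2 + \<omega>\<^sub>2\<^sup>2 * fst p) * snd p" using w by auto
    from phase_mean_props(4)[OF _ w(2) this, of "1 / g"]
    have "ln (1 / g) \<le> K p" unfolding K_def using g by (intro ln_mono) auto
    then show ?case using g by (simp add: ln_div)
  qed
  have "average_capacity M (instantaneous_snr gain g) = (\<integral>w. log 2 (1 + instantaneous_snr gain g w) \<partial>M)"
    using g by (intro average_capacity_eq) (simp_all add: instantaneous_snr_def[abs_def])
  also have "\<dots> = (\<integral>w. ln (1 + g * (cmod (gain w))\<^sup>2) \<partial>M) / ln 2"
    by (simp add: instantaneous_snr_def log_def)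
  also have "(\<integral>w. ln (1 + g * (cmod (gain w))\<^sup>2) \<partial>M)
      = enn2real (\<integral>\<^sup>+w. ennreal (ln (1 + g * (cmod (gain w))\<^sup>2)) \<partial>M)"
    using g by (intro integral_eq_nn_integral) auto
  also have "(\<integral>\<^sup>+w. ennreal (ln (1 + g * (cmod (gain w))\<^sup>2)) \<partial>M)
      = (\<integral>\<^sup>+x. \<integral>\<^sup>+y. ennreal (ln g + K (x, y)) \<partial>exponential_measure \<partial>exponential_measure)"
    using g by (subst nn_integral_gain) (simp_all add: K_def w(4))
  also have "\<dots> = (\<integral>\<^sup>+p. ennreal (ln g + K p) \<partial>(exponential_measure \<Otimes>\<^sub>M exponential_measure))"
    by (rule ex.nn_integral_fst) measurable
  also have "enn2real \<dots> = (\<integral>p. ln g + K p \<partial>(exponential_measure \<Otimes>\<^sub>M exponential_measure))"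
    by (rule integral_eq_nn_integral[symmetric]) (use nonneg in auto)
  also have "\<dots> = ln g + (\<integral>p. K p \<partial>(exponential_measure \<Otimes>\<^sub>M exponential_measure))"
    using tendsto_phase_mean_integral(2)[OF w(1-3) g] ex2.prob_space
    by (simp add: K_def)
  finally show ?thesis unfolding K_def .
qed

lemma tendsto_capacity_loss:
  "((\<lambda>g. log 2 g - average_capacity M (instantaneous_snr gain g))
    \<longlongrightarrow> capacity_loss (\<omega>\<^sub>2\<^sup>2) (\<omega>\<^sub>0\<^sup>2)) at_top"
proof (rule Lim_transform_eventually)
  let ?I = "\<lambda>g. \<integral>p. ln (phase_mean (1 / g) (\<omega>\<^sub>0\<^sup>2) ((1 - \<omega>\<^sub>2\<^sup>2 - \<omega>\<^sub>0\<^sup>2 + \<omega>\<^sub>2\<^sup>2 * fst p) * snd p))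
        \<partial>(exponential_measure \<Otimes>\<^sub>M exponential_measure)"
  have w: "0 \<le> \<omega>\<^sub>2\<^sup>2" "0 \<le> \<omega>\<^sub>0\<^sup>2" "\<omega>\<^sub>2\<^sup>2 + \<omega>\<^sub>0\<^sup>2 \<le> 1"
    using normalized zero_le_power2[of \<omega>\<^sub>1] by (simp_all, linarith)
  show "((\<lambda>g. - ?I g / ln 2) \<longlongrightarrow> capacity_loss (\<omega>\<^sub>2\<^sup>2) (\<omega>\<^sub>0\<^sup>2)) at_top"
    unfolding capacity_loss_eq(1)[OF w]
    by (intro tendsto_intros tendsto_phase_mean_integral w) simp
  show "\<forall>\<^sub>F g in at_top. - ?I g / ln 2 = log 2 g - average_capacity M (instantaneous_snr gain g)"
    using eventually_ge_at_top[of "1::real"]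
    by eventually_elim (simp add: average_capacity_gain log_def add_divide_distrib)
qed

end

theorem mainTheorem5:
  fixes M :: "'a measure" and \<phi> :: "'a \<Rightarrow> real" and G\<^sub>1 G\<^sub>2 G\<^sub>3 :: "'a \<Rightarrow> complex"
    and \<omega>\<^sub>0 \<omega>\<^sub>1 \<omega>\<^sub>2 \<alpha> \<beta> :: real and C :: "real \<Rightarrow> real"
  assumes "\<alpha> \<ge> 0" and "\<beta> \<ge> 0" and "\<alpha> + \<beta> \<le> 1"
    and "sosf_channel M \<phi> G\<^sub>1 G\<^sub>2 G\<^sub>3 \<omega>\<^sub>0 \<omega>\<^sub>1 \<omega>\<^sub>2"
    and "\<alpha> = \<omega>\<^sub>2\<^sup>2" and "\<beta> = \<omega>\<^sub>0\<^sup>2"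
    and "\<And>gbar. gbar > 0 \<Longrightarrow>
      C gbar = average_capacity M
        (instantaneous_snr (sosf_gain \<phi> G\<^sub>1 G\<^sub>2 G\<^sub>3 \<omega>\<^sub>0 \<omega>\<^sub>1 \<omega>\<^sub>2) gbar)"
  shows "((\<lambda>gbar. C gbar - (log 2 gbar - capacity_loss \<alpha> \<beta>)) \<longlongrightarrow> 0) at_top
    \<and> ((\<lambda>gbar. log 2 gbar - C gbar) \<longlongrightarrow> capacity_loss \<alpha> \<beta>) at_top
    \<and> (\<beta> = 0 \<longrightarrow>
        ((\<lambda>b. capacity_loss_expr (min \<alpha> (1 - b)) b) \<longlongrightarrow> capacity_loss \<alpha> \<beta>) (at_right 0))"
proof -
  interpret sosf_channel M \<phi> G\<^sub>1 G\<^sub>2 G\<^sub>3 \<omega>\<^sub>0 \<omega>\<^sub>1 \<omega>\<^sub>2 by fact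
  have lim: "((\<lambda>gbar. log 2 gbar - C gbar) \<longlongrightarrow> capacity_loss \<alpha> \<beta>) at_top"
  proof (rule Lim_transform_eventually)
    show "((\<lambda>g. log 2 g - average_capacity M (instantaneous_snr gain g)) \<longlongrightarrow> capacity_loss \<alpha> \<beta>) at_top"
      using tendsto_capacity_loss assms(5,6) by simp
    show "\<forall>\<^sub>F g in at_top. log 2 g - average_capacity M (instantaneous_snr gain g) = log 2 g - C g"
      using eventually_gt_at_top[of "0::real"] by eventually_elim (simp add: assms(7))
  qed
  moreover have "((\<lambda>gbar. C gbar - (log 2 gbar - capacity_loss \<alpha> \<beta>)) \<longlongrightarrow> 0) at_top"
    using tendsto_diff[OF tendsto_const[of "capacity_loss \<alpha> \<beta>"] lim] by (simp add: algebra_simps)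
  ultimately show ?thesis
    using capacity_loss_eq(2)[OF assms(1-3)] by blast
qed

end
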